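(* Let $M$ be a finitely presented special monoid with deterministic context-free word problem. Then $M$ is right cancellative, and the group of units $U(M)$ is a context-free group.
   Context: A monoid is special if it admits a monoid presentation in which every defining relation is of the form $w=1$; a finitely presented special monoid is one given by a finite presentation $\langle A \mid w_1=1,\dots,w_k=1\rangle$ (with $A$ finite). $U(M)$ is the group of all two-sided invertible elements of $M$. For a word $w=a_1\cdots a_n$, $w^{\mathrm{rev}}=a_n\cdots a_1$. For a monoid $M$ generated (as a monoid) by a finite set $A$, the word problem is the language $\mathrm{WP}_A^M=\{u\# v^{\mathrm{rev}} \mid u,v\in A^*,\ u=_M v\}$, where $\#\notin A$ and $u=_M v$ means that $u,v$ represent the same element of $M$. $M$ has deterministic context-free word problem if $\mathrm{WP}_A^M$ is a deterministic context-free language; this does not depend on the choice of finite generating set $A$. A context-free group is a finitely generated group whose word problem (equivalently, the language of words over a finite monoid generating set that represent the identity) is a context-free language. *)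

theory Defs
  imports "HOL-Algebra.Group"
begin

section \<open>Monoid presentations\<close>

text \<open>The congruence on the free monoid \<open>A*\<close> generated by a set \<open>R\<close> of pairs of words.\<close>

inductive_set pres_cong :: "'a set \<Rightarrow> ('a list \<times> 'a list) set \<Rightarrow> ('a list \<times> 'a list) set"
  for A :: "'a set" and R :: "('a list \<times> 'a list) set" where
  rel: "(u, v) \<in> R \<Longrightarrow> u \<in> lists A \<Longrightarrow> v \<in> lists A \<Longrightarrow> x \<in> lists A \<Longrightarrow> y \<in> lists A
          \<Longrightarrow> (x @ u @ y, x @ v @ y) \<in> pres_cong A R"
| refl: "u \<in> lists A \<Longrightarrow> (u, u) \<in> pres_cong A R"
| sym: "(u, v) \<in> pres_cong A R \<Longrightarrow> (v, u) \<in> pres_cong A R"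
| trans: "(u, v) \<in> pres_cong A R \<Longrightarrow> (v, w) \<in> pres_cong A R \<Longrightarrow> (u, w) \<in> pres_cong A R"

definition presented_monoid :: "'a set \<Rightarrow> ('a list \<times> 'a list) set \<Rightarrow> 'a list set monoid" where
  "presented_monoid A R =
     \<lparr>carrier = lists A // pres_cong A R,
      mult = (\<lambda>X Y. \<Union>u\<in>X. \<Union>v\<in>Y. pres_cong A R `` {u @ v}),
      one = pres_cong A R `` {[]}\<rparr>"

text \<open>Finite alphabets are taken to be finite sets of natural numbers, which loses no
  generality and lets definitions quantify over all of them.\<close>

definition fp_special_monoid :: "('m, 'x) monoid_scheme \<Rightarrow> bool" where
  "fp_special_monoid M \<longleftrightarrow> monoid M \<and>
     (\<exists>(A :: nat set) W. finite A \<and> finite W \<and> W \<subseteq> lists A \<and>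
        M \<cong> presented_monoid A {(w, []) | w. w \<in> W})"

definition right_cancellative :: "('m, 'x) monoid_scheme \<Rightarrow> bool" where
  "right_cancellative M \<longleftrightarrow>
     (\<forall>a\<in>carrier M. \<forall>b\<in>carrier M. \<forall>c\<in>carrier M.
        a \<otimes>\<^bsub>M\<^esub> c = b \<otimes>\<^bsub>M\<^esub> c \<longrightarrow> a = b)"


section \<open>Context-free and deterministic context-free languages\<close>

text \<open>A context-free grammar is given by a finite set of productions and a start symbol;
  \<open>Inl\<close> marks nonterminals and \<open>Inr\<close> terminals.\<close>

type_synonym 'a productions = "(nat \<times> (nat + 'a) list) set"

inductive derive_step :: "'a productions \<Rightarrow> (nat + 'a) list \<Rightarrow> (nat + 'a) list \<Rightarrow> bool"
  for P :: "'a productions" where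
  "(X, \<gamma>) \<in> P \<Longrightarrow> derive_step P (\<alpha> @ [Inl X] @ \<beta>) (\<alpha> @ \<gamma> @ \<beta>)"

definition context_free_language :: "'a list set \<Rightarrow> bool" where
  "context_free_language L \<longleftrightarrow>
     (\<exists>P S. finite P \<and> L = {w. (derive_step P)\<^sup>*\<^sup>* [Inl S] (map Inr w)})"

text \<open>A pushdown automaton with acceptance by final state. A transition \<open>(q, x, Z, p, \<gamma>)\<close>
  reads the input letter \<open>a\<close> if \<open>x = Some a\<close> and no input if \<open>x = None\<close>, and replaces the
  topmost stack symbol \<open>Z\<close> by the word \<open>\<gamma>\<close>; the top of the stack is the head of the list.
  The state set and the stack alphabet are left implicit: only the finitely many states
  and symbols occurring in the components matter.\<close>

record 'a pda =
  init_state :: nat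
  init_symbol :: nat
  final_states :: "nat set"
  transitions :: "(nat \<times> 'a option \<times> nat \<times> nat \<times> nat list) set"

inductive pda_step :: "'a pda \<Rightarrow> nat \<times> 'a list \<times> nat list \<Rightarrow> nat \<times> 'a list \<times> nat list \<Rightarrow> bool"
  for D :: "'a pda" where
  read: "(q, Some a, Z, p, \<gamma>) \<in> transitions D
           \<Longrightarrow> pda_step D (q, a # w, Z # \<sigma>) (p, w, \<gamma> @ \<sigma>)"
| silent: "(q, None, Z, p, \<gamma>) \<in> transitions D
           \<Longrightarrow> pda_step D (q, w, Z # \<sigma>) (p, w, \<gamma> @ \<sigma>)"

definition pda_language :: "'a pda \<Rightarrow> 'a list set" where
  "pda_language D =
     {w. \<exists>q\<in>final_states D. \<exists>\<sigma>.
        (pda_step D)\<^sup>*\<^sup>* (init_state D, w, [init_symbol D]) (q, [], \<sigma>)}"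

text \<open>Taking \<open>x = None\<close> below also says that a silent move available in state \<open>q\<close> with top
  symbol \<open>Z\<close> excludes every reading move there.\<close>

definition deterministic_pda :: "'a pda \<Rightarrow> bool" where
  "deterministic_pda D \<longleftrightarrow>
     (\<forall>q Z x p \<gamma> x' p' \<gamma>'.
        (q, x, Z, p, \<gamma>) \<in> transitions D \<longrightarrow> (q, x', Z, p', \<gamma>') \<in> transitions D \<longrightarrow>
        x = None \<or> x = x' \<longrightarrow> x = x' \<and> p = p' \<and> \<gamma> = \<gamma>')"

definition deterministic_context_free_language :: "'a list set \<Rightarrow> bool" where
  "deterministic_context_free_language L \<longleftrightarrow>
     (\<exists>D. finite (transitions D) \<and> finite (final_states D) \<and> deterministic_pda D \<and>
          L = pda_language D)"


section \<open>Word problems\<close>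

text \<open>A generating set is an alphabet \<open>A\<close> together with a map \<open>f\<close> interpreting its letters
  in \<open>M\<close>; \<open>f\<close> need not be injective, as for the letters of a presentation.\<close>

definition word_value :: "('m, 'x) monoid_scheme \<Rightarrow> ('a \<Rightarrow> 'm) \<Rightarrow> 'a list \<Rightarrow> 'm" where
  "word_value M f w = foldr (\<lambda>a x. f a \<otimes>\<^bsub>M\<^esub> x) w \<one>\<^bsub>M\<^esub>"

definition generates_monoid :: "('m, 'x) monoid_scheme \<Rightarrow> 'a set \<Rightarrow> ('a \<Rightarrow> 'm) \<Rightarrow> bool" where
  "generates_monoid M A f \<longleftrightarrow>
     f \<in> A \<rightarrow> carrier M \<and> carrier M = word_value M f ` lists A"

text \<open>\<open>None\<close> is the separator \<open>#\<close>.\<close>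

definition word_problem ::
  "('m, 'x) monoid_scheme \<Rightarrow> 'a set \<Rightarrow> ('a \<Rightarrow> 'm) \<Rightarrow> 'a option list set" where
  "word_problem M A f =
     {map Some u @ [None] @ map Some (rev v) | u v.
        u \<in> lists A \<and> v \<in> lists A \<and> word_value M f u = word_value M f v}"

text \<open>Neither of the following two properties depends on the choice of the finite
  generating set.\<close>

definition dcf_word_problem :: "('m, 'x) monoid_scheme \<Rightarrow> bool" where
  "dcf_word_problem M \<longleftrightarrow>
     (\<exists>(A :: nat set) f. finite A \<and> generates_monoid M A f \<and>
        deterministic_context_free_language (word_problem M A f))"

definition context_free_group :: "('m, 'x) monoid_scheme \<Rightarrow> bool" where
  "context_free_group G \<longleftrightarrow> group G \<and>
     (\<exists>(A :: nat set) f. finite A \<and> generates_monoid G A f \<and>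
        context_free_language (word_problem G A f))"

end

theory Submission
  imports Defs "HOL-Library.Sublist" "HOL-Library.Countable" "HOL-Library.Infinite_Set"
begin

text \<open>If \<open>p q = 1\<close> but \<open>q p \<noteq> 1\<close> in \<open>M\<close>, let the words \<open>P\<close>, \<open>Q\<close> represent \<open>p\<close>, \<open>q\<close>, and put \<open>X = Q\<close>,
  \<open>Y = rev Q\<close>, \<open>Z = rev P\<close>. Then \<open>X\<^sup>i # Y\<^sup>m Z\<^sup>n Y\<^sup>k\<close> lies in the word problem iff
  \<open>n \<le> m\<close> and \<open>i + n = k + m\<close>. A deterministic automaton cannot decide this: on powers of \<open>X\<close> its
  stack grows periodically, and reading \<open>Y\<^sup>i\<close> to compare \<open>i\<close> with \<open>m\<close> must pop the periodic part, after which
  \<open>i\<close> is forgotten and can no longer be compared with \<open>n\<close>. So one-sided inverses in \<open>M\<close> are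
  two-sided.

  In a special monoid all letters of the relators are then units, and the other letters are free, which
  gives right cancellation. Moreover a product of generators is a unit only if every factor is, so the word
  problem of the group of units is that of \<open>M\<close> restricted to the invertible generators, and
  the language of a pushdown automaton is context-free.\<close>

section \<open>Runs of pushdown automata\<close>

lemma pda_step_append:
  "pda_step D (q, u, \<sigma>) (p, v, \<tau>) \<Longrightarrow> pda_step D (q, u @ w, \<sigma> @ \<rho>) (p, v @ w, \<tau> @ \<rho>)"
  by (erule pda_step.cases) (auto intro: pda_step.intros)

lemma pda_steps_append:
  assumes "(pda_step D)\<^sup>*\<^sup>* (q, u, \<sigma>) (p, v, \<tau>)"
  shows "(pda_step D)\<^sup>*\<^sup>* (q, u @ w, \<sigma> @ \<rho>) (p, v @ w, \<tau> @ \<rho>)"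
  using assms
proof (induction "(p, v, \<tau>)" arbitrary: p v \<tau> rule: rtranclp_induct)
  case base
  then show ?case by simp
next
  case (step y)
  then show ?case
    by (metis pda_step_append prod.collapse rtranclp.rtrancl_into_rtrancl)
qed

lemma pda_steps_stack:
  "(pda_step D)\<^sup>*\<^sup>* (q, u, \<sigma>) (p, v, \<tau>) \<Longrightarrow> (pda_step D)\<^sup>*\<^sup>* (q, u, \<sigma> @ \<rho>) (p, v, \<tau> @ \<rho>)"
  using pda_steps_append[where w = "[]"] by force

lemma pda_step_consumes:
  assumes "pda_step D (q, u, \<sigma>) (p, v, \<tau>)"
  shows "\<exists>g. u = g @ v \<and> (\<forall>w. pda_step D (q, g @ w, \<sigma>) (p, w, \<tau>))"
  using assms
proof cases
  case (read a Z \<gamma> \<sigma>')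
  then show ?thesis
    by (intro exI[of _ "[a]"]) (auto intro: pda_step.intros)
next
  case (silent Z \<gamma> \<sigma>')
  then show ?thesis
    by (intro exI[of _ "[]"]) (auto intro: pda_step.intros)
qed

text \<open>A move sees only the letter it reads, so the same moves work when the unread input
  \<open>v\<close> is exchanged for any \<open>w\<close>. Runs can thus be spliced with other
  continuations of the input.\<close>

lemma pda_run_consumes:
  assumes "(pda_step D ^^ n) (q, u, \<sigma>) (p, v, \<tau>)"
  shows "\<exists>g. u = g @ v \<and> (\<forall>w. (pda_step D ^^ n) (q, g @ w, \<sigma>) (p, w, \<tau>))"
  using assms
proof (induction n arbitrary: p v \<tau>)
  case 0
  then show ?case by simp
next
  case (Suc n)
  obtain p' v' \<tau>' where s: "(pda_step D ^^ n) (q, u, \<sigma>) (p', v', \<tau>')"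
    "pda_step D (p', v', \<tau>') (p, v, \<tau>)"
    using Suc.prems by auto
  obtain g where g: "u = g @ v'" "\<And>w. (pda_step D ^^ n) (q, g @ w, \<sigma>) (p', w, \<tau>')"
    using Suc.IH[OF s(1)] by blast
  obtain h where h: "v' = h @ v" "\<And>w. pda_step D (p', h @ w, \<tau>') (p, w, \<tau>)"
    using pda_step_consumes[OF s(2)] by blast
  have "(pda_step D ^^ Suc n) (q, (g @ h) @ w, \<sigma>) (p, w, \<tau>)" for w
    using g(2)[of "h @ w"] h(2)[of w] by auto
  then show ?case using g(1) h(1) by (intro exI[of _ "g @ h"]) auto
qed

lemma pda_steps_consume:
  assumes "(pda_step D)\<^sup>*\<^sup>* (q, u, \<sigma>) (p, v, \<tau>)"
  shows "\<exists>g. u = g @ v \<and> (\<forall>w. (pda_step D)\<^sup>*\<^sup>* (q, g @ w, \<sigma>) (p, w, \<tau>))"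
  using assms by (meson pda_run_consumes relpowp_imp_rtranclp rtranclp_imp_relpowp)

lemma pda_steps_no_input:
  "(pda_step D)\<^sup>*\<^sup>* (q, [], \<sigma>) (p, v, \<tau>) \<Longrightarrow> v = []"
  by (drule pda_steps_consume) simp

lemma pda_step_stack_inv:
  assumes "pda_step D (q, u, \<sigma> @ \<rho>) (p, v, \<tau>)" "\<sigma> \<noteq> []"
  shows "\<exists>\<tau>'. \<tau> = \<tau>' @ \<rho> \<and> pda_step D (q, u, \<sigma>) (p, v, \<tau>')"
  using assms by (cases \<sigma>) (auto elim!: pda_step.cases intro: pda_step.intros)

text \<open>Cut the run when \<open>\<sigma>\<close> has just been popped: before that moment no
  move sees \<open>\<rho>\<close>. Step counts are kept because the grammar construction inducts on
  the length of runs.\<close>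

lemma pda_run_split:
  assumes "(pda_step D ^^ n) (q, u, \<sigma> @ \<rho>) (p, v, \<tau>)"
  shows "(\<exists>\<tau>'. \<tau> = \<tau>' @ \<rho> \<and> (pda_step D ^^ n) (q, u, \<sigma>) (p, v, \<tau>')) \<or>
    (\<exists>k m r w. k + m = n \<and> (pda_step D ^^ k) (q, u, \<sigma>) (r, w, []) \<and>
       (pda_step D ^^ m) (r, w, \<rho>) (p, v, \<tau>))"
  using assms
proof (induction n arbitrary: q u \<sigma>)
  case 0
  then show ?case by auto
next
  case (Suc n)
  show ?case
  proof (cases "\<sigma> = []")
    case True
    then have "0 + Suc n = Suc n \<and> (pda_step D ^^ 0) (q, u, \<sigma>) (q, u, []) \<and>
       (pda_step D ^^ Suc n) (q, u, \<rho>) (p, v, \<tau>)"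
      using Suc.prems by simp
    then show ?thesis by blast
  next
    case False
    obtain q1 u1 \<sigma>1 where s: "pda_step D (q, u, \<sigma> @ \<rho>) (q1, u1, \<sigma>1)"
      "(pda_step D ^^ n) (q1, u1, \<sigma>1) (p, v, \<tau>)"
      using Suc.prems by (metis prod.collapse relpowp_Suc_E2)
    obtain \<sigma>2 where t: "\<sigma>1 = \<sigma>2 @ \<rho>" "pda_step D (q, u, \<sigma>) (q1, u1, \<sigma>2)"
      using pda_step_stack_inv[OF s(1) False] by blast
    from Suc.IH[OF s(2)[unfolded t(1)]] show ?thesis
    proof (elim disjE exE conjE)
      fix \<tau>' assume "\<tau> = \<tau>' @ \<rho>" "(pda_step D ^^ n) (q1, u1, \<sigma>2) (p, v, \<tau>')"
      then show ?thesis using t(2) by (blast intro: relpowp_Suc_I2)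
    next
      fix k m r w
      assume h: "k + m = n" "(pda_step D ^^ k) (q1, u1, \<sigma>2) (r, w, [])"
        "(pda_step D ^^ m) (r, w, \<rho>) (p, v, \<tau>)"
      have "(pda_step D ^^ Suc k) (q, u, \<sigma>) (r, w, [])"
        using t(2) h(2) by (rule relpowp_Suc_I2)
      moreover have "Suc k + m = Suc n" using h by simp
      ultimately show ?thesis using h(3) by blast
    qed
  qed
qed

text \<open>Stop the run as soon as \<open>u\<close> is read; the moves up to there do not depend on
  \<open>w\<close>.\<close>

lemma pda_steps_prefix:
  assumes "(pda_step D)\<^sup>*\<^sup>* (q, u @ w, \<sigma>) (p, [], \<tau>)"
  shows "\<exists>p' \<tau>'. (pda_step D)\<^sup>*\<^sup>* (q, u, \<sigma>) (p', [], \<tau>')"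
  using assms
proof (induction "(q, u @ w, \<sigma>)" arbitrary: q u \<sigma> rule: converse_rtranclp_induct)
  case base
  then show ?case by auto
next
  case (step y)
  show ?case
  proof (cases "u = []")
    case True
    then show ?thesis by blast
  next
    case False
    obtain q1 u1 \<sigma>1 where y: "y = (q1, u1 @ w, \<sigma>1)" "pda_step D (q, u, \<sigma>) (q1, u1, \<sigma>1)"
      using step(1) False
      by (cases u; elim pda_step.cases; clarsimp) (blast intro: pda_step.intros)+
    then show ?thesis
      using step(3)[OF y(1)] by (meson converse_rtranclp_into_rtranclp)
  qed
qed

section \<open>Deterministic runs\<close>

lemma deterministic_step:
  assumes "deterministic_pda D" "pda_step D c c1" "pda_step D c c2"
  shows "c1 = c2"
proof -
  have *: "x = x' \<and> p = p' \<and> \<gamma> = \<gamma>'"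
    if "(q, x, Z, p, \<gamma>) \<in> transitions D" "(q, x', Z, p', \<gamma>') \<in> transitions D"
      "x = None \<or> x' = None \<or> x = x'"
    for q Z x p \<gamma> x' p' \<gamma>'
    using assms(1) that unfolding deterministic_pda_def by metis
  from assms(2) show ?thesis
  proof cases
    case r: (read q a Z p \<gamma> w \<sigma>)
    from assms(3)[unfolded r(1)] show ?thesis
      by cases (use r *[OF r(3)] in auto)
  next
    case r: (silent q Z p \<gamma> w \<sigma>)
    from assms(3)[unfolded r(1)] show ?thesis
      by cases (use r *[OF r(3)] in auto)
  qed
qed

text \<open>Induct along the first run: while it is still behind \<open>c2\<close>, determinism
  forces its next move to be that of the run to \<open>c2\<close>.\<close>

lemma deterministic_steps_linear:
  assumes "deterministic_pda D" "(pda_step D)\<^sup>*\<^sup>* c c1" "(pda_step D)\<^sup>*\<^sup>* c c2"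
  shows "(pda_step D)\<^sup>*\<^sup>* c1 c2 \<or> (pda_step D)\<^sup>*\<^sup>* c2 c1"
  using assms(2)
proof (induction rule: rtranclp_induct)
  case base
  then show ?case using assms(3) by blast
next
  case (step y z)
  show ?case
  proof (cases "y = c2")
    case True
    then show ?thesis using step(2) by blast
  next
    case False
    from step(3) show ?thesis
    proof
      assume "(pda_step D)\<^sup>*\<^sup>* y c2"
      with False obtain y' where "pda_step D y y'" "(pda_step D)\<^sup>*\<^sup>* y' c2"
        by (metis converse_rtranclpE)
      then show ?thesis using deterministic_step[OF assms(1)] step(2) by blast
    next
      assume "(pda_step D)\<^sup>*\<^sup>* c2 y"
      then show ?thesis using step(2) by (meson rtranclp.rtrancl_into_rtrancl)
    qed
  qed
qed

lemma deterministic_relpowp: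
  assumes "deterministic_pda D" "(pda_step D ^^ n) c c1" "(pda_step D ^^ n) c c2"
  shows "c1 = c2"
  using assms(2,3)
proof (induction n arbitrary: c1 c2)
  case 0
  then show ?case by simp
next
  case (Suc n)
  obtain b1 b2 where "(pda_step D ^^ n) c b1" "pda_step D b1 c1"
    "(pda_step D ^^ n) c b2" "pda_step D b2 c2"
    using Suc.prems by auto
  then show ?case using Suc.IH deterministic_step[OF assms(1)] by blast
qed

definition accepting :: "'a pda \<Rightarrow> nat \<times> 'a list \<times> nat list \<Rightarrow> bool" where
  "accepting D c \<longleftrightarrow> (\<exists>q\<in>final_states D. \<exists>\<sigma>. (pda_step D)\<^sup>*\<^sup>* c (q, [], \<sigma>))"

lemma mem_pda_language:
  "w \<in> pda_language D \<longleftrightarrow> accepting D (init_state D, w, [init_symbol D])"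
  by (simp add: pda_language_def accepting_def)

lemma accepting_backward:
  "(pda_step D)\<^sup>*\<^sup>* c c' \<Longrightarrow> accepting D c' \<Longrightarrow> accepting D c"
  unfolding accepting_def by (meson rtranclp_trans)

text \<open>Nonempty \<open>v\<close> puts \<open>(r, v, \<tau>)\<close> before the accepting
  configuration on the unique path, since empty input leads only to empty input. With
  \<open>v = []\<close> silent moves might already have left the last accepting
  configuration.\<close>

lemma accepting_forward:
  assumes "deterministic_pda D" "(pda_step D)\<^sup>*\<^sup>* c (r, v, \<tau>)" "v \<noteq> []" "accepting D c"
  shows "accepting D (r, v, \<tau>)"
  using assms unfolding accepting_def
  by (meson deterministic_steps_linear pda_steps_no_input)

section \<open>Powers of words and periodic runs of deterministic automata\<close>

primrec word_pow :: "'a list \<Rightarrow> nat \<Rightarrow> 'a list" where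
  "word_pow w 0 = []"
| "word_pow w (Suc n) = w @ word_pow w n"

lemma word_pow_Suc2: "word_pow w (Suc n) = word_pow w n @ w"
  by (induction n) auto

lemma map_upt_append: "a \<le> b \<Longrightarrow> b \<le> c \<Longrightarrow> map f [a..<b] @ map f [b..<c] = map f [a..<c]"
  by (metis le_add_diff_inverse map_append upt_add_eq_append)

lemma word_pow_eq_Nil: "word_pow w n = [] \<longleftrightarrow> w = [] \<or> n = 0"
  by (induction n) auto

text \<open>The window may start anywhere, because the period of the run found below can begin
  inside a copy of \<open>X\<close>.\<close>

lemma word_pow_periodic:
  assumes per: "\<And>k. \<omega> (k + l) = \<omega> k"
  shows "word_pow (map \<omega> [a..<a + l]) n = map \<omega> [a..<a + n * l]"
proof (induction n)
  case 0
  then show ?case by simp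
next
  case (Suc n)
  have sh: "\<omega> (k + n * l) = \<omega> k" for k
    by (induction n) (use per in \<open>auto simp: add.assoc[symmetric] add.commute[of l]\<close>)
  have "map \<omega> [a + n * l..<a + Suc n * l] = map (\<lambda>k. \<omega> (k + n * l)) [a..<a + l]"
    by (rule nth_equalityI) (auto simp: ac_simps)
  then have "map \<omega> [a + n * l..<a + Suc n * l] = map \<omega> [a..<a + l]"
    by (simp add: sh)
  then show ?case
    using Suc upt_add_eq_append[of a "a + n * l" l]
    by (simp only: word_pow_Suc2) (simp add: ac_simps)
qed

text \<open>At infinitely many times the stack never gets lower again. Two such times with equal state, top
  symbol and position in \<open>X\<close> delimit a period.\<close>

lemma deterministic_run_periodic:
  assumes det: "deterministic_pda D" and fin: "finite (transitions D)" and X: "X \<noteq> []"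
    and prefixes: "\<And>n. \<exists>w. word_pow X n @ w \<in> pda_language D"
  shows "\<exists>d g h r i p Z \<rho> \<delta>. d \<ge> (1::nat) \<and> (\<forall>t. g @ word_pow h t @ r = word_pow X (i + t * d)) \<and>
    (\<forall>w. (pda_step D)\<^sup>*\<^sup>* (init_state D, g @ w, [init_symbol D]) (p, w, Z # \<rho>)) \<and>
    (\<forall>w. (pda_step D)\<^sup>*\<^sup>* (p, h @ w, [Z]) (p, w, Z # \<delta>))"
proof -
  define l where "l = length X"
  have l: "l > 0" using X l_def by simp
  \<comment> \<open>The infinite word X X X ...; inputs become windows
    \<open>map \<omega> [a..<b]\<close> and positions become numbers.\<close>
  define \<omega> where "\<omega> k = X ! (k mod l)" for k
  have per: "\<omega> (k + j * l) = \<omega> k" for j k by (simp add: \<omega>_def)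
  have X_eq: "X = map \<omega> [0..<0 + l]"
    by (rule nth_equalityI) (auto simp: \<omega>_def l_def)
  have X_pow: "word_pow X n = map \<omega> [0..<n * l]" for n
    using word_pow_periodic[of \<omega> l 0 n] per[of _ 1] X_eq by (metis add_0 mult_1)
  \<comment> \<open>From position \<open>k\<close> on, \<open>\<omega>\<close> can still be read
    arbitrarily far; by determinism the automaton then neither blocks nor loops silently
    forever.\<close>
  define live where "live = (\<lambda>(q, k, \<sigma>). \<forall>n\<ge>k. \<exists>p \<tau>. (pda_step D)\<^sup>*\<^sup>* (q, map \<omega> [k..<n], \<sigma>) (p, [], \<tau>))"
  define ostep where "ostep = (\<lambda>(q, k, \<sigma>) (q', k', \<sigma>'). k \<le> k' \<and>
    (\<forall>w. pda_step D (q, map \<omega> [k..<k'] @ w, \<sigma>) (q', w, \<sigma>')))"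
  have live_init: "live (init_state D, 0, [init_symbol D])"
    unfolding live_def
  proof (clarsimp)
    fix n
    obtain w where w: "accepting D (init_state D, word_pow X n @ w, [init_symbol D])"
      using prefixes mem_pda_language by metis
    have "n \<le> n * l" using l by simp
    then have "word_pow X n = map \<omega> [0..<n] @ map \<omega> [n..<n * l]"
      unfolding X_pow by (metis le_add_diff_inverse map_append upt_add_eq_append zero_le)
    then show "\<exists>p \<tau>. (pda_step D)\<^sup>*\<^sup>* (init_state D, map \<omega> [0..<n], [init_symbol D]) (p, [], \<tau>)"
      using w pda_steps_prefix unfolding accepting_def by (metis append.assoc)
  qed
  \<comment> \<open>A live configuration must move, since the next letter is still to be read. Its
    only move lies on every run that reads further, so liveness persists.\<close>
  have live_step: "\<exists>c'. live c' \<and> ostep c c'" if lv: "live c" for c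
  proof -
    obtain q k \<sigma> where c: "c = (q, k, \<sigma>)" by (cases c)
    obtain p \<tau> where "(pda_step D)\<^sup>*\<^sup>* (q, [\<omega> k], \<sigma>) (p, [], \<tau>)"
      using lv unfolding c live_def by (auto dest!: spec[of _ "Suc k"])
    then obtain p' u \<sigma>' where s: "pda_step D (q, [\<omega> k], \<sigma>) (p', u, \<sigma>')"
      by (metis converse_rtranclpE list.distinct(1) prod.inject prod_cases3)
    obtain v where v: "[\<omega> k] = v @ u" "\<And>w. pda_step D (q, v @ w, \<sigma>) (p', w, \<sigma>')"
      using pda_step_consumes[OF s] by blast
    define k' where "k' = k + length v"
    have vk: "map \<omega> [k..<k + length v] = v" using v(1) by (cases v) auto
    have os: "ostep c (p', k', \<sigma>')"
      using v(2) vk unfolding ostep_def c by (simp add: k'_def)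
    have "live (p', k', \<sigma>')"
      unfolding live_def
    proof clarsimp
      fix n assume n: "n \<ge> k'"
      obtain p2 \<tau>2 where p2: "(pda_step D)\<^sup>*\<^sup>* (q, map \<omega> [k..<n], \<sigma>) (p2, [], \<tau>2)"
        using lv le_trans[OF le_add1 n[unfolded k'_def]] unfolding c live_def by auto
      have "map \<omega> [k..<n] = v @ map \<omega> [k'..<n]"
        using upt_add_eq_append[of k k' "n - k'"] n vk by (simp add: k'_def)
      then have "pda_step D (q, map \<omega> [k..<n], \<sigma>) (p', map \<omega> [k'..<n], \<sigma>')"
        using v(2) by simp
      then have "(pda_step D)\<^sup>*\<^sup>* (p', map \<omega> [k'..<n], \<sigma>') (p2, [], \<tau>2) \<or>
        (pda_step D)\<^sup>*\<^sup>* (p2, [], \<tau>2) (p', map \<omega> [k'..<n], \<sigma>')"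
        using deterministic_steps_linear[OF det] p2 by blast
      then show "\<exists>p \<tau>. (pda_step D)\<^sup>*\<^sup>* (p', map \<omega> [k'..<n], \<sigma>') (p, [], \<tau>)"
        by (metis pda_steps_no_input rtranclp.rtrancl_refl)
    qed
    then show ?thesis using os by blast
  qed
  obtain F where F: "\<And>n. live (F n)" "F 0 = (init_state D, 0, [init_symbol D])"
    "\<And>n. ostep (F n) (F (Suc n))"
    using dependent_nat_choice[of "\<lambda>n c. live c \<and> (n = 0 \<longrightarrow> c = (init_state D, 0, [init_symbol D]))"
        "\<lambda>n. ostep"] live_init live_step by (metis (no_types, lifting) old.nat.distinct(1))
  define st pos stk where "st n = fst (F n)" and "pos n = fst (snd (F n))" and "stk n = snd (snd (F n))" for n
  have F_eq: "F n = (st n, pos n, stk n)" for n by (simp add: st_def pos_def stk_def)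
  have pos_mono: "pos n \<le> pos (Suc n)" and
    stp: "pda_step D (st n, map \<omega> [pos n..<pos (Suc n)] @ w, stk n) (st (Suc n), w, stk (Suc n))" for n w
    using F(3)[of n] by (auto simp: ostep_def F_eq)
  have pos_le: "m \<le> n \<Longrightarrow> pos m \<le> pos n" for m n
    using pos_mono by (rule lift_Suc_mono_le)
  have ne: "stk n \<noteq> []" for n using stp[of n "[]"] by (auto elim: pda_step.cases)
  \<comment> \<open>If all positions stayed below \<open>n\<close>, the run on the prefix of length
    \<open>n\<close> would have input left after every number of steps. Liveness of the start gives
    a number \<open>L\<close> of steps after which none is left.\<close>
  have unb: "\<exists>m. pos m \<ge> n" for n
  proof (rule ccontr)
    assume "\<nexists>m. n \<le> pos m"
    then have less: "pos m < n" for m by (meson not_le)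
    have run: "(pda_step D ^^ m) (init_state D, map \<omega> [0..<n], [init_symbol D])
        (st m, map \<omega> [pos m..<n], stk m)" for m
    proof (induction m)
      case 0
      then show ?case using F(2) by (simp add: F_eq)
    next
      case (Suc m)
      have "map \<omega> [pos m..<n] = map \<omega> [pos m..<pos (Suc m)] @ map \<omega> [pos (Suc m)..<n]"
        using pos_mono[of m] less[of "Suc m"]
        by (metis le_add_diff_inverse map_append nat_less_le upt_add_eq_append)
      then show ?case using Suc stp[of m "map \<omega> [pos (Suc m)..<n]"] by auto
    qed
    obtain p \<tau> where "(pda_step D)\<^sup>*\<^sup>* (init_state D, map \<omega> [0..<n], [init_symbol D]) (p, [], \<tau>)"
      using live_init unfolding live_def by fastforce
    then obtain L where "(pda_step D ^^ L) (init_state D, map \<omega> [0..<n], [init_symbol D]) (p, [], \<tau>)"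
      by (meson rtranclp_imp_relpowp)
    then have "map \<omega> [pos L..<n] = []"
      using deterministic_relpowp[OF det] run by (metis prod.inject)
    then show False using less[of L] by simp
  qed
  define E where "E = {n. \<forall>m\<ge>n. length (stk n) \<le> length (stk m)}"
  have "\<exists>n'\<ge>n. n' \<in> E" for n
  proof -
    \<comment> \<open>A time of least stack height among those from \<open>n\<close> on belongs to
      \<open>E\<close>.\<close>
    obtain n' where n': "n' \<ge> n" "\<forall>m. m \<ge> n \<longrightarrow> length (stk n') \<le> length (stk m)"
      using ex_has_least_nat[of "\<lambda>m. m \<ge> n" n "\<lambda>m. length (stk m)"] by blast
    have "n' \<in> E" unfolding E_def using n' by simp
    then show ?thesis using n'(1) by blast
  qed
  then have infE: "infinite E" by (meson infinite_nat_iff_unbounded_le)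
  define ty where "ty n = (st n, hd (stk n), pos n mod l)" for n
  have "ty n \<in> (\<lambda>((q, x, Z, p, \<gamma>), j). (q, Z, j)) ` (transitions D \<times> {..<l})" for n
  proof -
    obtain x \<gamma> where "(st n, x, hd (stk n), st (Suc n), \<gamma>) \<in> transitions D"
      using stp[of n "[]"] by (cases rule: pda_step.cases) auto
    then have "((st n, x, hd (stk n), st (Suc n), \<gamma>), pos n mod l) \<in> transitions D \<times> {..<l}"
      using l by simp
    then show ?thesis unfolding ty_def by (rule rev_image_eqI) simp
  qed
  then have "finite (ty ` E)"
    using fin by (meson finite_SigmaI finite_imageI finite_lessThan finite_subset image_subsetI)
  then obtain n1 where n1: "n1 \<in> E" "infinite {n \<in> E. ty n = ty n1}"
    using pigeonhole_infinite infE by blast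
  \<comment> \<open>Equal types could also occur around a silent stretch. Choosing \<open>n2\<close>
    after the position has increased makes the period read input, which yields
    \<open>d \<ge> 1\<close>.\<close>
  obtain m where m: "pos m \<ge> Suc (pos n1)" using unb by blast
  obtain n2 where n2: "n2 \<ge> m" "n2 \<in> E" "ty n2 = ty n1"
    using n1(2) unfolding infinite_nat_iff_unbounded_le by blast
  have pos12: "pos n1 < pos n2" using m n2(1) pos_le[of m n2] by linarith
  then have n12: "n1 \<le> n2" using pos_le[of n2 n1] by (meson nat_le_linear not_le)
  obtain Z \<rho> where Z: "stk n1 = Z # \<rho>" using ne by (meson neq_Nil_conv)
  \<comment> \<open>As \<open>n1\<close> is in \<open>E\<close>, the part of the stack above
    \<open>\<rho>\<close> never becomes empty after \<open>n1\<close>. So \<open>\<rho>\<close> is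
    never looked at, and the run can be replayed on the stack \<open>[Z]\<close>.\<close>
  have "\<exists>\<tau>. stk n = \<tau> @ \<rho> \<and> \<tau> \<noteq> [] \<and>
      (\<forall>w. (pda_step D)\<^sup>*\<^sup>* (st n1, map \<omega> [pos n1..<pos n] @ w, [Z]) (st n, w, \<tau>))" if "n1 \<le> n" for n
    using that
  proof (induction n rule: dec_induct)
    case base
    then show ?case using Z by simp
  next
    case (step n)
    then obtain \<tau> where t: "stk n = \<tau> @ \<rho>" "\<tau> \<noteq> []"
      "\<And>w. (pda_step D)\<^sup>*\<^sup>* (st n1, map \<omega> [pos n1..<pos n] @ w, [Z]) (st n, w, \<tau>)" by blast
    obtain \<tau>' where t': "stk (Suc n) = \<tau>' @ \<rho>"
      using pda_step_stack_inv[OF stp[of n "[]", unfolded t(1)] t(2)] by blast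
    have s': "pda_step D (st n, map \<omega> [pos n..<pos (Suc n)] @ w, \<tau>) (st (Suc n), w, \<tau>')" for w
      using pda_step_stack_inv[OF stp[of n w, unfolded t(1)] t(2)] t' by auto
    have "length (stk n1) \<le> length (stk (Suc n))"
      using n1(1) step.hyps(1) unfolding E_def by simp
    then have "\<tau>' \<noteq> []" using t' Z by auto
    moreover have "(pda_step D)\<^sup>*\<^sup>* (st n1, map \<omega> [pos n1..<pos (Suc n)] @ w, [Z]) (st (Suc n), w, \<tau>')" for w
    proof -
      have "map \<omega> [pos n1..<pos (Suc n)] = map \<omega> [pos n1..<pos n] @ map \<omega> [pos n..<pos (Suc n)]"
        using pos_mono[of n] pos_le[OF step.hyps(1)]
        by (metis le_add_diff_inverse map_append upt_add_eq_append)
      then show ?thesis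
        using t(3)[of "map \<omega> [pos n..<pos (Suc n)] @ w"] s'[of w]
        by (simp add: rtranclp.rtrancl_into_rtrancl)
    qed
    ultimately show ?case using t' by blast
  qed
  from this[OF n12] obtain \<tau> where \<tau>: "stk n2 = \<tau> @ \<rho>" "\<tau> \<noteq> []"
    "\<And>w. (pda_step D)\<^sup>*\<^sup>* (st n1, map \<omega> [pos n1..<pos n2] @ w, [Z]) (st n2, w, \<tau>)" by blast
  have ty12: "st n2 = st n1" "hd \<tau> = Z" "pos n2 mod l = pos n1 mod l"
    using n2(3) Z \<tau>(1,2) by (auto simp: ty_def)
  obtain d where d: "pos n2 = pos n1 + d * l"
    using ty12(3) pos12 by (metis mod_eq_nat2E mult.commute nat_less_le)
  have init_run: "(pda_step D)\<^sup>*\<^sup>* (init_state D, map \<omega> [0..<pos n] @ w, [init_symbol D]) (st n, w, stk n)" for n w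
  proof (induction n arbitrary: w)
    case 0
    then show ?case using F(2) by (simp add: F_eq)
  next
    case (Suc n)
    have "map \<omega> [0..<pos (Suc n)] = map \<omega> [0..<pos n] @ map \<omega> [pos n..<pos (Suc n)]"
      using pos_mono[of n] by (metis le_add_diff_inverse map_append upt_add_eq_append zero_le)
    then show ?case
      using Suc[of "map \<omega> [pos n..<pos (Suc n)] @ w"] stp[of n w]
      by (simp add: rtranclp.rtrancl_into_rtrancl)
  qed
  \<comment> \<open>Go up from \<open>pos n1\<close> to a multiple of \<open>l\<close>: the rest
    \<open>r\<close> of the current copy of \<open>X\<close> completes the word read to a power of
    \<open>X\<close>.\<close>
  define i where "i = Suc (pos n1 div l)"
  have i: "pos n1 \<le> i * l" unfolding i_def
    by (metis add.commute dividend_less_div_times l less_imp_le mult_Suc)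
  have words: "map \<omega> [0..<pos n1] @ word_pow (map \<omega> [pos n1..<pos n2]) t @ map \<omega> [pos n1..<i * l]
      = word_pow X (i + t * d)" for t
  proof -
    have 1: "word_pow (map \<omega> [pos n1..<pos n2]) t = map \<omega> [pos n1..<pos n1 + t * (d * l)]"
      unfolding d by (rule word_pow_periodic) (rule per)
    have 2: "map \<omega> [pos n1..<i * l] = map \<omega> [pos n1 + t * (d * l)..<i * l + t * (d * l)]"
    proof (rule nth_equalityI; clarsimp)
      fix j
      show "\<omega> (pos n1 + j) = \<omega> (pos n1 + t * (d * l) + j)"
        using per[of "pos n1 + j" "t * d"] by (simp add: ac_simps)
    qed
    have 3: "map \<omega> [pos n1..<pos n1 + t * (d * l)] @ map \<omega> [pos n1 + t * (d * l)..<i * l + t * (d * l)]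
       = map \<omega> [pos n1..<i * l + t * (d * l)]"
      by (rule map_upt_append) (use i in auto)
    have 4: "map \<omega> [0..<pos n1] @ map \<omega> [pos n1..<i * l + t * (d * l)] = map \<omega> [0..<i * l + t * (d * l)]"
      by (rule map_upt_append) (use i in auto)
    have "(i + t * d) * l = i * l + t * (d * l)" by (simp add: algebra_simps)
    then show ?thesis unfolding 1 2 3 4 X_pow by simp
  qed
  have "(pda_step D)\<^sup>*\<^sup>* (init_state D, map \<omega> [0..<pos n1] @ w, [init_symbol D]) (st n1, w, Z # \<rho>)" for w
    using init_run[of n1 w] Z by simp
  moreover have "(pda_step D)\<^sup>*\<^sup>* (st n1, map \<omega> [pos n1..<pos n2] @ w, [Z]) (st n1, w, Z # tl \<tau>)" for w
    using \<tau>(3)[of w] \<tau>(2) ty12(1,2) by (metis list.collapse)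
  moreover have "d \<ge> 1" using d pos12 by (cases d) auto
  ultimately show ?thesis using words by blast
qed

text \<open>Strip copies of \<open>Y\<close> from the right of \<open>y\<close> as long as they fit.
  What is left comes from a finite set that does not depend on \<open>N\<close>, which prepares a
  pigeonhole argument.\<close>

lemma suffix_of_power_word:
  assumes "g @ y = b @ word_pow Y N"
  shows "\<exists>z e. e \<le> N \<and> y = z @ word_pow Y e \<and> g @ z = b @ word_pow Y (N - e) \<and>
    z \<in> set (suffixes b) \<union> set (suffixes Y)"
  using assms
proof (induction N arbitrary: y)
  case 0
  then have "suffix y b" by (auto simp: suffix_def)
  then show ?case using 0 by auto
next
  case (Suc N)
  then have "g @ y = (b @ word_pow Y N) @ Y" by (simp add: word_pow_Suc2 del: word_pow.simps)
  then consider v where "y = v @ Y" "g @ v = b @ word_pow Y N" | v where "Y = v @ y"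
    unfolding append_eq_append_conv2 by blast
  then show ?case
  proof cases
    case 1
    from Suc.IH[OF 1(2)] obtain z e where "e \<le> N" "v = z @ word_pow Y e"
      "g @ z = b @ word_pow Y (N - e)" "z \<in> set (suffixes b) \<union> set (suffixes Y)" by blast
    then show ?thesis using 1
      by (intro exI[of _ z] exI[of _ "Suc e"]) (simp add: word_pow_Suc2 del: word_pow.simps)
  next
    case 2
    then have "y \<in> set (suffixes Y)" by (auto simp: suffix_def)
    then show ?thesis using Suc.prems
      by (intro exI[of _ y] exI[of _ 0]) auto
  qed
qed

text \<open>With \<open>(p, A # \<delta>\<^sup>t @ \<rho>)\<close> the configurations reached on powers of \<open>X\<close>, the accepting run on
  \<open>X\<^sup>N S Y\<^sup>N\<close> has to pop \<open>A # \<delta>\<^sup>t\<close>, for otherwise the same moves accept \<open>X\<^sup>N\<^sup>+\<^sup>d S Y\<^sup>N\<close>. After the pop,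
  only the state and a bounded part of the input distinguish the runs for different \<open>t\<close>.\<close>

lemma no_deterministic_pda_for_bicyclic:
  assumes det: "deterministic_pda D" and fin: "finite (transitions D)" and X: "X \<noteq> []"
    and balanced: "\<And>i m. word_pow X i @ S @ word_pow Y m \<in> pda_language D \<longleftrightarrow> i = m"
    and return: "\<And>i m. word_pow X i @ S @ word_pow Y m @ word_pow Z m @ word_pow Y i \<in> pda_language D"
    and return_less: "\<And>i m i' m'. word_pow X i' @ S @ word_pow Y m' @ word_pow Z m @ word_pow Y i \<in> pda_language D
      \<Longrightarrow> m \<le> m' \<and> i' + m = i + m'"
  shows False
proof -
  have Y: "Y \<noteq> []"
  proof
    assume "Y = []"
    then show False using balanced[of 0 0] balanced[of 0 1] by simp
  qed
  have prefixes: "\<exists>w. word_pow X n @ w \<in> pda_language D" for n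
    using return[of n 0] by blast
  obtain d g h r i p A \<rho> \<delta> where d: "d \<ge> (1::nat)"
    and words: "\<And>t. g @ word_pow h t @ r = word_pow X (i + t * d)"
    and run0: "\<And>w. (pda_step D)\<^sup>*\<^sup>* (init_state D, g @ w, [init_symbol D]) (p, w, A # \<rho>)"
    and run1: "\<And>w. (pda_step D)\<^sup>*\<^sup>* (p, h @ w, [A]) (p, w, A # \<delta>)"
    using deterministic_run_periodic[OF det fin X prefixes] by metis
  have runt: "(pda_step D)\<^sup>*\<^sup>* (p, word_pow h t @ w, [A]) (p, w, A # word_pow \<delta> t)" for t w
  proof (induction t arbitrary: w)
    case 0
    then show ?case by simp
  next
    case (Suc t)
    have "(pda_step D)\<^sup>*\<^sup>* (p, h @ w, A # word_pow \<delta> t) (p, w, A # word_pow \<delta> (Suc t))"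
      using pda_steps_stack[OF run1[of w], of "word_pow \<delta> t"] by simp
    then show ?case
      using Suc[of "h @ w"] by (simp add: word_pow_Suc2 del: word_pow.simps)
  qed
  have reach: "(pda_step D)\<^sup>*\<^sup>* (init_state D, word_pow X (i + t * d) @ w, [init_symbol D])
      (p, r @ w, A # word_pow \<delta> t @ \<rho>)" for t w
  proof -
    have "(pda_step D)\<^sup>*\<^sup>* (p, word_pow h t @ r @ w, [A] @ \<rho>) (p, r @ w, (A # word_pow \<delta> t) @ \<rho>)"
      by (rule pda_steps_stack[OF runt])
    then show ?thesis
      using run0[of "word_pow h t @ r @ w"] words[of t, symmetric] by simp
  qed
  \<comment> \<open>\<open>g\<close> is the input read from \<open>p\<close> on until
    \<open>A # word_pow \<delta> t\<close> is popped, and \<open>z @ word_pow Y e\<close> is what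
    then remains. \<open>t \<ge> 1\<close> makes the exponent positive, so that input is left and
    acceptance can be carried forward.\<close>
  have pop: "\<exists>q z e g. e \<le> i + t * d \<and> g @ z = (r @ S) @ word_pow Y (i + t * d - e) \<and>
      z \<in> set (suffixes (r @ S)) \<union> set (suffixes Y) \<and> q \<in> (\<lambda>(q, x, Z, p, \<gamma>). p) ` transitions D \<and>
      (\<forall>w. (pda_step D)\<^sup>*\<^sup>* (p, g @ w, A # word_pow \<delta> t) (q, w, []))" if "t \<ge> 1" for t
  proof -
    define N where "N = i + t * d"
    have N: "N \<ge> 1" unfolding N_def using d that by (cases t) auto
    have "accepting D (init_state D, word_pow X N @ S @ word_pow Y N, [init_symbol D])"
      using balanced mem_pda_language by metis
    moreover have ne: "r @ S @ word_pow Y N \<noteq> []" using Y N by (simp add: word_pow_eq_Nil)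
    ultimately have "accepting D (p, r @ S @ word_pow Y N, A # word_pow \<delta> t @ \<rho>)"
      using reach[of t "S @ word_pow Y N"] accepting_forward[OF det] unfolding N_def by blast
    then obtain f \<tau> where f: "f \<in> final_states D"
      "(pda_step D)\<^sup>*\<^sup>* (p, r @ S @ word_pow Y N, (A # word_pow \<delta> t) @ \<rho>) (f, [], \<tau>)"
      unfolding accepting_def by auto
    obtain n where n: "(pda_step D ^^ n) (p, r @ S @ word_pow Y N, (A # word_pow \<delta> t) @ \<rho>) (f, [], \<tau>)"
      using f(2) by (meson rtranclp_imp_relpowp)
    from pda_run_split[OF n] consider \<tau>' where
      "(pda_step D)\<^sup>*\<^sup>* (p, r @ S @ word_pow Y N, A # word_pow \<delta> t) (f, [], \<tau>')"
      | q y where "(pda_step D)\<^sup>*\<^sup>* (p, r @ S @ word_pow Y N, A # word_pow \<delta> t) (q, y, [])"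
      by (meson relpowp_imp_rtranclp)
    then show ?thesis
    proof cases
      case 1
      have "accepting D (p, r @ S @ word_pow Y N, A # word_pow \<delta> (Suc t) @ \<rho>)"
        using pda_steps_stack[OF 1, of "\<delta> @ \<rho>"] f(1)
        unfolding accepting_def by (auto simp: word_pow_Suc2 simp del: word_pow.simps)
      then have "word_pow X (N + d) @ S @ word_pow Y N \<in> pda_language D"
        using accepting_backward[OF reach[of "Suc t" "S @ word_pow Y N"]]
        unfolding N_def mem_pda_language by (simp add: ac_simps)
      then show ?thesis using balanced d by simp
    next
      case 2
      obtain g where g: "r @ S @ word_pow Y N = g @ y"
        "\<And>w. (pda_step D)\<^sup>*\<^sup>* (p, g @ w, A # word_pow \<delta> t) (q, w, [])"
        using pda_steps_consume[OF 2] by blast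
      obtain z e where ze: "e \<le> N" "y = z @ word_pow Y e" "g @ z = (r @ S) @ word_pow Y (N - e)"
        "z \<in> set (suffixes (r @ S)) \<union> set (suffixes Y)"
        using suffix_of_power_word[of g y "r @ S" Y N] g(1) by auto
      \<comment> \<open>The stack went from nonempty to empty, so a move was made and
        \<open>q\<close> is the target of a transition.\<close>
      have "q \<in> (\<lambda>(q, x, Z, p, \<gamma>). p) ` transitions D"
        using 2 by (cases rule: rtranclp.cases) (force elim!: pda_step.cases)+
      then show ?thesis using ze g unfolding N_def by blast
    qed
  qed
  obtain q z e g where pop: "\<And>t. t \<ge> 1 \<Longrightarrow> e t \<le> i + t * d"
    "\<And>t. t \<ge> 1 \<Longrightarrow> g t @ z t = (r @ S) @ word_pow Y (i + t * d - e t)"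
    "\<And>t. t \<ge> 1 \<Longrightarrow> z t \<in> set (suffixes (r @ S)) \<union> set (suffixes Y)"
    "\<And>t. t \<ge> 1 \<Longrightarrow> q t \<in> (\<lambda>(q, x, Z, p, \<gamma>). p) ` transitions D"
    "\<And>t w. t \<ge> 1 \<Longrightarrow> (pda_step D)\<^sup>*\<^sup>* (p, g t @ w, A # word_pow \<delta> t) (q t, w, [])"
    using pop by metis
  have "(\<lambda>t. (z t, q t)) ` {1..} \<subseteq> (set (suffixes (r @ S)) \<union> set (suffixes Y)) \<times>
      (\<lambda>(q, x, Z, p, \<gamma>). p) ` transitions D"
    using pop(3,4) by (intro image_subsetI SigmaI) simp_all
  then have "finite ((\<lambda>t. (z t, q t)) ` {1..})"
    using fin by (meson List.finite_set finite_SigmaI finite_UnI finite_imageI finite_subset)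
  then have "\<not> inj_on (\<lambda>t. (z t, q t)) {1..}"
    using finite_imageD infinite_Ici by blast
  then obtain t t' where tt: "t \<ge> 1" "t' \<ge> 1" "t \<noteq> t'" "z t = z t'" "q t = q t'"
    unfolding inj_on_def by auto
  \<comment> \<open>After \<open>word_pow X (i + t * d) @ S @ word_pow Y (m t)\<close> the state is
    \<open>q t\<close>, the unread input \<open>z t\<close> and the stack \<open>\<rho>\<close>:
    only \<open>q t\<close> and \<open>z t\<close> still remember \<open>t\<close>.\<close>
  define m where "m t = i + t * d - e t" for t
  have run: "(pda_step D)\<^sup>*\<^sup>* (init_state D, word_pow X (i + t * d) @ S @ word_pow Y (m t) @ w, [init_symbol D])
      (q t, z t @ w, \<rho>)" if "t \<ge> 1" for t w
  proof -
    have eq: "r @ S @ word_pow Y (m t) @ w = g t @ z t @ w"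
      using pop(2)[OF that] unfolding m_def by (metis append.assoc)
    have "(pda_step D)\<^sup>*\<^sup>* (p, r @ S @ word_pow Y (m t) @ w, A # word_pow \<delta> t @ \<rho>) (q t, z t @ w, \<rho>)"
      using pda_steps_stack[OF pop(5)[OF that, of "z t @ w"], of \<rho>] unfolding eq by simp
    with reach show ?thesis by (rule rtranclp_trans)
  qed
  \<comment> \<open>The inputs for \<open>s\<close> and \<open>s'\<close> lead to one configuration,
    so the word completing the first also completes the second. With the roles exchanged this gives
    \<open>m s = m s'\<close> and then \<open>s * d = s' * d\<close>.\<close>
  have same: "m s \<le> m s' \<and> (i + s' * d) + m s = (i + s * d) + m s'"
    if s: "s \<ge> 1" "s' \<ge> 1" "z s = z s'" "q s = q s'" for s s'
  proof -
    define w where "w = word_pow Z (m s) @ word_pow Y (i + s * d)"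
    have "i + s * d > 0" using s d by (cases s) auto
    then have w: "z s @ w \<noteq> []" unfolding w_def using Y by (simp only: append_is_Nil_conv word_pow_eq_Nil) simp
    have "accepting D (init_state D, word_pow X (i + s * d) @ S @ word_pow Y (m s) @ w, [init_symbol D])"
      using return[of "i + s * d" "m s"] mem_pda_language unfolding w_def by metis
    then have "accepting D (q s, z s @ w, \<rho>)"
      using accepting_forward[OF det run[OF s(1)]] w by blast
    then have "accepting D (init_state D, word_pow X (i + s' * d) @ S @ word_pow Y (m s') @ w, [init_symbol D])"
      using accepting_backward[OF run[OF s(2)]] s by metis
    then show ?thesis
      using return_less[of "i + s' * d" "m s'" "m s" "i + s * d"] mem_pda_language unfolding w_def by metis
  qed
  have "m t = m t'" "t * d = t' * d"
    using same[of t t'] same[of t' t] tt by auto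
  then show False using d tt(3) by simp
qed

section \<open>Grammars of pushdown automata\<close>

lemma derive_step_context:
  "derive_step P \<phi> \<psi> \<Longrightarrow> derive_step P (\<alpha> @ \<phi> @ \<beta>) (\<alpha> @ \<psi> @ \<beta>)"
proof (erule derive_step.cases)
  fix X \<gamma> \<alpha>' \<beta>'
  assume "\<phi> = \<alpha>' @ [Inl X] @ \<beta>'" "\<psi> = \<alpha>' @ \<gamma> @ \<beta>'" "(X, \<gamma>) \<in> P"
  then show ?thesis
    using derive_step.intros[of X \<gamma> P "\<alpha> @ \<alpha>'" "\<beta>' @ \<beta>"] by simp
qed

lemma derive_steps_context:
  "(derive_step P)\<^sup>*\<^sup>* \<phi> \<psi> \<Longrightarrow> (derive_step P)\<^sup>*\<^sup>* (\<alpha> @ \<phi> @ \<beta>) (\<alpha> @ \<psi> @ \<beta>)"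
  by (induction rule: rtranclp_induct) (auto intro: rtranclp.rtrancl_into_rtrancl derive_step_context)

lemma derive_steps_append:
  assumes "(derive_step P)\<^sup>*\<^sup>* \<phi> \<phi>'" "(derive_step P)\<^sup>*\<^sup>* \<psi> \<psi>'"
  shows "(derive_step P)\<^sup>*\<^sup>* (\<phi> @ \<psi>) (\<phi>' @ \<psi>')"
  using derive_steps_context[OF assms(1), of "[]" \<psi>] derive_steps_context[OF assms(2), of \<phi>' "[]"]
  by auto

lemma derive_step_production: "(X, \<gamma>) \<in> P \<Longrightarrow> derive_step P [Inl X] \<gamma>"
  using derive_step.intros[of X \<gamma> P "[]" "[]"] by simp

section \<open>The triple construction for pushdown automata\<close>

text \<open>The target \<open>Some p\<close> stands for emptying the stack in state \<open>p\<close>, the target \<open>None\<close> for reaching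
  a final state with any stack.\<close>

definition reaches_target :: "'a pda \<Rightarrow> nat option \<Rightarrow> nat \<Rightarrow> nat list \<Rightarrow> bool" where
  "reaches_target D t q \<sigma> \<longleftrightarrow>
     (case t of Some p \<Rightarrow> q = p \<and> \<sigma> = [] | None \<Rightarrow> q \<in> final_states D)"

definition target_language :: "'a pda \<Rightarrow> nat option \<Rightarrow> nat \<Rightarrow> nat list \<Rightarrow> 'a list set" where
  "target_language D t q \<sigma> =
     {w. \<exists>p \<tau>. (pda_step D)\<^sup>*\<^sup>* (q, w, \<sigma>) (p, [], \<tau>) \<and> reaches_target D t p \<tau>}"

definition pda_nt :: "nat \<Rightarrow> nat \<Rightarrow> nat option \<Rightarrow> nat" where
  "pda_nt q Z t = to_nat (q, Z, t)"

lemma pda_nt_inject [simp]: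
  "pda_nt q Z t = pda_nt q' Z' t' \<longleftrightarrow> q = q' \<and> Z = Z' \<and> t = t'"
  by (simp add: pda_nt_def)

text \<open>The sentential forms obtained by guessing the states in which the successive symbols of a
  stack word are popped; for the target \<open>None\<close> the run may end before a symbol is popped.\<close>

fun guesses :: "'a pda \<Rightarrow> nat set \<Rightarrow> nat option \<Rightarrow> nat \<Rightarrow> nat list \<Rightarrow> (nat + 'a) list set" where
  "guesses D Q t q [] = (if reaches_target D t q [] then {[]} else {})"
| "guesses D Q t q (Z # \<sigma>) =
     (\<Union>s\<in>Q. (#) (Inl (pda_nt q Z (Some s))) ` guesses D Q t s \<sigma>) \<union>
     (if t = None then {[Inl (pda_nt q Z None)]} else {})"

text \<open>Only states entered by a move: these are the ones in which a symbol can just have been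
  popped.\<close>

definition pda_states :: "'a pda \<Rightarrow> nat set" where
  "pda_states D = (\<lambda>(q, x, Z, p, \<gamma>). p) ` transitions D"

definition pda_symbols :: "'a pda \<Rightarrow> nat set" where
  "pda_symbols D = insert (init_symbol D) (\<Union>(q, x, Z, p, \<gamma>)\<in>transitions D. set \<gamma>)"

definition pda_targets :: "'a pda \<Rightarrow> nat option set" where
  "pda_targets D = insert None (Some ` pda_states D)"

text \<open>\<open>pda_nt q Z t\<close> is to generate the inputs leading from state
  \<open>q\<close> and stack \<open>[Z]\<close> to the target \<open>t\<close>. A production guesses
  the first move and how the pushed word is dealt with; the empty productions let a run with target
  \<open>None\<close> stop in a final state.\<close>

definition pda_productions :: "'a pda \<Rightarrow> 'a productions" where
  "pda_productions D =
     (\<Union>(q, x, Z, p, \<gamma>)\<in>transitions D. \<Union>t\<in>pda_targets D. \<Union>\<phi>\<in>guesses D (pda_states D) t p \<gamma>.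
        {(pda_nt q Z t, (case x of None \<Rightarrow> [] | Some a \<Rightarrow> [Inr a]) @ \<phi>)}) \<union>
     (\<lambda>(q, Z). (pda_nt q Z None, [])) ` (final_states D \<times> pda_symbols D)"

lemma finite_guesses: "finite Q \<Longrightarrow> finite (guesses D Q t q \<sigma>)"
  by (induction D Q t q \<sigma> rule: guesses.induct) auto

lemma finite_pda_productions:
  assumes "finite (transitions D)" "finite (final_states D)"
  shows "finite (pda_productions D)"
proof -
  have Q: "finite (pda_states D)" using assms by (simp add: pda_states_def)
  have "finite (pda_symbols D)" using assms by (auto simp: pda_symbols_def)
  then show ?thesis
    using assms Q unfolding pda_productions_def pda_targets_def
    by (auto intro!: finite_UN_I finite_guesses)
qed

lemma target_language_Cons:
  assumes "u \<in> target_language D (Some s) q [Z]" "v \<in> target_language D t s \<sigma>"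
  shows "u @ v \<in> target_language D t q (Z # \<sigma>)"
proof -
  have "(pda_step D)\<^sup>*\<^sup>* (q, u, [Z]) (s, [], [])"
    using assms(1) by (auto simp: target_language_def reaches_target_def)
  then have "(pda_step D)\<^sup>*\<^sup>* (q, u @ v, Z # \<sigma>) (s, v, \<sigma>)"
    using pda_steps_append[of D q u "[Z]" s "[]" "[]" v \<sigma>] by simp
  then show ?thesis
    using assms(2) unfolding target_language_def by (blast intro: rtranclp_trans)
qed

lemma target_language_None_stack:
  assumes "w \<in> target_language D None q \<sigma>"
  shows "w \<in> target_language D None q (\<sigma> @ \<rho>)"
proof -
  obtain f \<tau> where "(pda_step D)\<^sup>*\<^sup>* (q, w, \<sigma>) (f, [], \<tau>)" "f \<in> final_states D"
    using assms by (auto simp: target_language_def reaches_target_def)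
  then show ?thesis
    using pda_steps_stack[of D q w \<sigma> f "[]" \<tau> \<rho>]
    by (auto simp: target_language_def reaches_target_def)
qed

section \<open>Soundness: sentential forms interpreted by languages\<close>

fun form_language :: "(nat \<Rightarrow> 'a list set) \<Rightarrow> (nat + 'a) list \<Rightarrow> 'a list set" where
  "form_language L [] = {[]}"
| "form_language L (Inr a # \<phi>) = (#) a ` form_language L \<phi>"
| "form_language L (Inl X # \<phi>) = {u @ v | u v. u \<in> L X \<and> v \<in> form_language L \<phi>}"

lemma form_language_append:
  "form_language L (\<phi> @ \<psi>) = {u @ v | u v. u \<in> form_language L \<phi> \<and> v \<in> form_language L \<psi>}"
proof (induction L \<phi> rule: form_language.induct)
  case (1 L)
  then show ?case by simp
next
  case (2 L a \<phi>)
  show ?case (is "?l = ?r")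
  proof
    show "?l \<subseteq> ?r"
    proof
      fix w assume "w \<in> ?l"
      then obtain v v' where "w = (a # v) @ v'" "v \<in> form_language L \<phi>" "v' \<in> form_language L \<psi>"
        using 2 by auto
      moreover from this have "a # v \<in> form_language L (Inr a # \<phi>)" by simp
      ultimately show "w \<in> ?r" by blast
    qed
    show "?r \<subseteq> ?l" using 2 by fastforce
  qed
next
  case (3 L X \<phi>)
  show ?case (is "?l = ?r")
  proof
    show "?l \<subseteq> ?r"
    proof
      fix w assume "w \<in> ?l"
      then obtain u v v' where "w = u @ v @ v'" "u \<in> L X" "v \<in> form_language L \<phi>" "v' \<in> form_language L \<psi>"
        using 3 by auto
      moreover from this have "u @ v \<in> form_language L (Inl X # \<phi>)" by auto
      moreover have "w = (u @ v) @ v'" using calculation(1) by simp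
      ultimately show "w \<in> ?r" by blast
    qed
    show "?r \<subseteq> ?l"
    proof
      fix w assume "w \<in> ?r"
      then obtain u v v' where "w = (u @ v) @ v'" "u \<in> L X" "v \<in> form_language L \<phi>" "v' \<in> form_language L \<psi>"
        by auto
      moreover from this have "v @ v' \<in> form_language L (\<phi> @ \<psi>)" using 3 by auto
      ultimately show "w \<in> ?l" by auto
    qed
  qed
qed

lemma form_language_terminals: "form_language L (map Inr w) = {w}"
  by (induction w) auto

text \<open>If \<open>L\<close> is closed under the productions, rewriting a nonterminal can only
  shrink the interpretation of a form. A terminal word, interpreted as itself, then lies in the
  language of the start symbol.\<close>

lemma form_language_derive:
  assumes "\<And>X \<gamma>. (X, \<gamma>) \<in> P \<Longrightarrow> form_language L \<gamma> \<subseteq> L X"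
    and "(derive_step P)\<^sup>*\<^sup>* \<phi> \<psi>"
  shows "form_language L \<psi> \<subseteq> form_language L \<phi>"
  using assms(2)
proof (induction rule: rtranclp_induct)
  case base
  then show ?case by simp
next
  case (step \<psi> \<psi>')
  from step(2) have "form_language L \<psi>' \<subseteq> form_language L \<psi>"
  proof cases
    case (1 X \<gamma> \<alpha> \<beta>)
    then have "form_language L \<gamma> \<subseteq> form_language L [Inl X]"
      using assms(1) by auto
    then show ?thesis
      unfolding 1(1,2) form_language_append by blast
  qed
  then show ?case using step by blast
qed

definition pda_nt_language :: "'a pda \<Rightarrow> nat \<Rightarrow> 'a list set" where
  "pda_nt_language D X = {w. \<exists>q Z t. X = pda_nt q Z t \<and> w \<in> target_language D t q [Z]}"

lemma pda_nt_language [simp]: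
  "pda_nt_language D (pda_nt q Z t) = target_language D t q [Z]"
  by (auto simp: pda_nt_language_def)

lemma guesses_sound:
  "\<phi> \<in> guesses D Q t q \<sigma> \<Longrightarrow> form_language (pda_nt_language D) \<phi> \<subseteq> target_language D t q \<sigma>"
proof (induction D Q t q \<sigma> arbitrary: \<phi> rule: guesses.induct)
  case (1 D Q t q)
  then show ?case by (auto simp: target_language_def split: if_splits)
next
  case (2 D Q t q Z \<sigma>)
  from 2(2) consider s \<psi> where "s \<in> Q" "\<psi> \<in> guesses D Q t s \<sigma>"
      "\<phi> = Inl (pda_nt q Z (Some s)) # \<psi>"
    | "t = None" "\<phi> = [Inl (pda_nt q Z None)]"
    by (auto split: if_splits)
  then show ?case
  proof cases
    case 1
    then show ?thesis using 2(1)[OF 1(1,2)] by (auto intro: target_language_Cons)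
  next
    case 2
    then show ?thesis using target_language_None_stack[of _ D q "[Z]" \<sigma>] by auto
  qed
qed

lemma pda_productions_sound:
  assumes "(X, \<gamma>) \<in> pda_productions D"
  shows "form_language (pda_nt_language D) \<gamma> \<subseteq> pda_nt_language D X"
proof -
  consider q x Z p \<tau> t \<phi> where "(q, x, Z, p, \<tau>) \<in> transitions D" "\<phi> \<in> guesses D (pda_states D) t p \<tau>"
      "X = pda_nt q Z t" "\<gamma> = (case x of None \<Rightarrow> [] | Some a \<Rightarrow> [Inr a]) @ \<phi>"
    | q Z where "q \<in> final_states D" "X = pda_nt q Z None" "\<gamma> = []"
    using assms unfolding pda_productions_def by auto
  then show ?thesis
  proof cases
    case 1
    have step: "pda_step D (q, (case x of None \<Rightarrow> [] | Some a \<Rightarrow> [a]) @ w, [Z]) (p, w, \<tau>)" for w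
      using 1(1) pda_step.read[of q _ Z p \<tau> D w "[]"] pda_step.silent[of q Z p \<tau> D w "[]"]
      by (cases x) auto
    have "(case x of None \<Rightarrow> [] | Some a \<Rightarrow> [a]) @ w \<in> target_language D t q [Z]"
      if "w \<in> target_language D t p \<tau>" for w
      using that step[of w] unfolding target_language_def by (blast intro: converse_rtranclp_into_rtranclp)
    then show ?thesis
      using guesses_sound[OF 1(2)] 1(3,4) by (cases x) auto
  next
    case 2
    then show ?thesis by (auto simp: target_language_def reaches_target_def)
  qed
qed

section \<open>Completeness: from runs to derivations\<close>

lemma pda_step_empty_stack: "\<not> pda_step D (q, w, []) c"
  by (auto elim: pda_step.cases)

text \<open>Strong induction on the length of the run. For a single stack symbol the first move
  selects the production and a shorter run treats the pushed word; a longer stack is handled by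
  cutting the run where its top symbol is popped.\<close>

lemma guesses_complete:
  assumes "(pda_step D ^^ n) (q, w, \<sigma>) (p, [], \<tau>)" "reaches_target D t p \<tau>"
    "t \<in> pda_targets D" "set \<sigma> \<subseteq> pda_symbols D"
  shows "(\<exists>\<phi>\<in>guesses D (pda_states D) t q \<sigma>. (derive_step (pda_productions D))\<^sup>*\<^sup>* \<phi> (map Inr w)) \<and>
    (\<forall>Z. \<sigma> = [Z] \<longrightarrow> (derive_step (pda_productions D))\<^sup>*\<^sup>* [Inl (pda_nt q Z t)] (map Inr w))"
  using assms
proof (induction n arbitrary: q w \<sigma> p \<tau> t rule: less_induct)
  case (less n q w \<sigma> p \<tau> t)
  let ?P = "pda_productions D"
  have IH: "\<exists>\<phi>\<in>guesses D (pda_states D) o1 q1 \<sigma>1. (derive_step ?P)\<^sup>*\<^sup>* \<phi> (map Inr w1)"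
    if "m < n" "(pda_step D ^^ m) (q1, w1, \<sigma>1) (p1, [], \<tau>1)"
      "reaches_target D o1 p1 \<tau>1" "o1 \<in> pda_targets D" "set \<sigma>1 \<subseteq> pda_symbols D" for m o1 q1 \<sigma>1 w1 p1 \<tau>1
    by (rule conjunct1[OF less.IH[OF that]])
  \<comment> \<open>Lengths up to and including \<open>n\<close> are covered, since popping the top
    symbol can take the whole run.\<close>
  have single: "(derive_step ?P)\<^sup>*\<^sup>* [Inl (pda_nt q Z o1)] (map Inr w1)"
    if run: "(pda_step D ^^ m) (q, w1, [Z]) (p1, [], \<tau>1)" and m: "m \<le> n"
      and t: "reaches_target D o1 p1 \<tau>1" "o1 \<in> pda_targets D" "Z \<in> pda_symbols D" for m w1 Z o1 p1 \<tau>1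
  proof (cases m)
    case 0
    then have "w1 = []" "o1 = None" "q \<in> final_states D"
      using run t(1) by (auto simp: reaches_target_def split: option.splits)
    moreover from this have "(pda_nt q Z None, []) \<in> ?P"
      using t(3) unfolding pda_productions_def by (intro UnI2 image_eqI[where x = "(q, Z)"]) simp_all
    ultimately show ?thesis using derive_step_production[of "pda_nt q Z None" "[]"] by auto
  next
    case (Suc k)
    then obtain q2 w2 \<sigma>2 where s: "pda_step D (q, w1, [Z]) (q2, w2, \<sigma>2)"
      "(pda_step D ^^ k) (q2, w2, \<sigma>2) (p1, [], \<tau>1)"
      using run by (metis prod.collapse relpowp_Suc_E2)
    obtain x where x: "(q, x, Z, q2, \<sigma>2) \<in> transitions D" "w1 = (case x of None \<Rightarrow> [] | Some a \<Rightarrow> [a]) @ w2"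
      using s(1) by cases force+
    have "set \<sigma>2 \<subseteq> pda_symbols D" using x(1) by (force simp: pda_symbols_def)
    then obtain \<phi> where \<phi>: "\<phi> \<in> guesses D (pda_states D) o1 q2 \<sigma>2" "(derive_step ?P)\<^sup>*\<^sup>* \<phi> (map Inr w2)"
      using IH[OF _ s(2) t(1,2)] Suc m by auto
    have "(pda_nt q Z o1, (case x of None \<Rightarrow> [] | Some a \<Rightarrow> [Inr a]) @ \<phi>) \<in> ?P"
      unfolding pda_productions_def
      by (rule UnI1, rule UN_I[OF x(1)]) (use t(2) \<phi>(1) in auto)
    then have "derive_step ?P [Inl (pda_nt q Z o1)] ((case x of None \<Rightarrow> [] | Some a \<Rightarrow> [Inr a]) @ \<phi>)"
      by (rule derive_step_production)
    moreover have "(derive_step ?P)\<^sup>*\<^sup>* ((case x of None \<Rightarrow> [] | Some a \<Rightarrow> [Inr a]) @ \<phi>) (map Inr w1)"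
      using derive_steps_append[OF rtranclp.rtrancl_refl \<phi>(2), of "case x of None \<Rightarrow> [] | Some a \<Rightarrow> [Inr a]"] x(2)
      by (cases x) simp_all
    ultimately show ?thesis by (rule converse_rtranclp_into_rtranclp)
  qed
  have "\<exists>\<phi>\<in>guesses D (pda_states D) t q \<sigma>. (derive_step ?P)\<^sup>*\<^sup>* \<phi> (map Inr w)"
  proof (cases \<sigma>)
    case Nil
    then have "n = 0"
      using less.prems(1) pda_step_empty_stack by (metis not0_implies_Suc relpowp_Suc_D2)
    then show ?thesis using Nil less.prems by auto
  next
    case (Cons Z \<sigma>')
    have sym: "Z \<in> pda_symbols D" "set \<sigma>' \<subseteq> pda_symbols D" using less.prems(4) Cons by auto
    have "(pda_step D ^^ n) (q, w, [Z] @ \<sigma>') (p, [], \<tau>)" using less.prems(1) Cons by simp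
    from pda_run_split[OF this] consider
      (unpopped) \<tau>' where "(pda_step D ^^ n) (q, w, [Z]) (p, [], \<tau>')" "t = None"
    | (popped) k m r v where "k \<le> n" "m < n" "(pda_step D ^^ k) (q, w, [Z]) (r, v, [])"
        "(pda_step D ^^ m) (r, v, \<sigma>') (p, [], \<tau>)"
    proof (elim disjE exE conjE)
      fix \<tau>' assume t: "\<tau> = \<tau>' @ \<sigma>'" "(pda_step D ^^ n) (q, w, [Z]) (p, [], \<tau>')"
      show thesis
      proof (cases t)
        case None
        then show thesis using unpopped t(2) by blast
      next
        case (Some s)
        then have "\<tau> = []" using less.prems(2) by (simp add: reaches_target_def)
        \<comment> \<open>The final stack is empty, hence so is \<open>\<sigma>'\<close>: the whole
          run counts as the pop, followed by zero steps.\<close>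
        then show thesis using popped[of n 0 p "[]"] t by (cases n) simp_all
      qed
    next
      fix k m r v
      assume "k + m = n" "(pda_step D ^^ k) (q, w, [Z]) (r, v, [])" "(pda_step D ^^ m) (r, v, \<sigma>') (p, [], \<tau>)"
      \<comment> \<open>Popping \<open>Z\<close> takes at least one move, hence
        \<open>m < n\<close>.\<close>
      then show thesis using popped[of k m r v] by (cases k) simp_all
    qed
    then show ?thesis
    proof cases
      case unpopped
      have "reaches_target D None p \<tau>'"
        using less.prems(2) unpopped(2) by (simp add: reaches_target_def)
      then have "(derive_step ?P)\<^sup>*\<^sup>* [Inl (pda_nt q Z None)] (map Inr w)"
        using single[OF unpopped(1) order_refl] sym(1) by (simp add: pda_targets_def)
      then show ?thesis using unpopped(2) Cons by auto
    next
      case popped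
      obtain u where u: "w = u @ v" "(pda_step D ^^ k) (q, u, [Z]) (r, [], [])"
        using pda_run_consumes[OF popped(3)] by (metis append_Nil2)
      have r: "r \<in> pda_states D"
      proof (cases k)
        case 0
        then show ?thesis using u(2) by simp
      next
        case (Suc k')
        then show ?thesis using u(2) by (force elim!: pda_step.cases simp: pda_states_def)
      qed
      have "(derive_step ?P)\<^sup>*\<^sup>* [Inl (pda_nt q Z (Some r))] (map Inr u)"
        using single[OF u(2) popped(1), of "Some r"] r sym(1) by (simp add: pda_targets_def reaches_target_def)
      moreover obtain \<phi> where \<phi>: "\<phi> \<in> guesses D (pda_states D) t r \<sigma>'" "(derive_step ?P)\<^sup>*\<^sup>* \<phi> (map Inr v)"
        using IH[OF popped(2,4) less.prems(2,3) sym(2)] by blast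
      ultimately have "(derive_step ?P)\<^sup>*\<^sup>* (Inl (pda_nt q Z (Some r)) # \<phi>) (map Inr w)"
        using derive_steps_append[of ?P "[Inl (pda_nt q Z (Some r))]" "map Inr u" \<phi> "map Inr v"] u(1) by simp
      moreover have "Inl (pda_nt q Z (Some r)) # \<phi> \<in> guesses D (pda_states D) t q \<sigma>"
        using Cons r \<phi>(1) by auto
      ultimately show ?thesis by blast
    qed
  qed
  moreover have "(derive_step ?P)\<^sup>*\<^sup>* [Inl (pda_nt q Z t)] (map Inr w)" if "\<sigma> = [Z]" for Z
    using single[OF less.prems(1)[unfolded that] order_refl less.prems(2,3)] less.prems(4) that by simp
  ultimately show ?case by blast
qed

theorem context_free_pda_language:
  assumes "finite (transitions D)" "finite (final_states D)"
  shows "context_free_language (pda_language D)"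
proof -
  let ?P = "pda_productions D" and ?S = "pda_nt (init_state D) (init_symbol D) None"
  have L: "pda_language D = target_language D None (init_state D) [init_symbol D]"
    by (auto simp: pda_language_def target_language_def reaches_target_def)
  have "w \<in> pda_language D" if "(derive_step ?P)\<^sup>*\<^sup>* [Inl ?S] (map Inr w)" for w
  proof -
    have "w \<in> form_language (pda_nt_language D) (map Inr w)" by (simp add: form_language_terminals)
    then have "w \<in> form_language (pda_nt_language D) [Inl ?S]"
      using form_language_derive[of ?P "pda_nt_language D", OF pda_productions_sound that] by blast
    then show ?thesis by (simp add: L)
  qed
  moreover have "(derive_step ?P)\<^sup>*\<^sup>* [Inl ?S] (map Inr w)" if w: "w \<in> pda_language D" for w
  proof -
    obtain f \<tau> where f: "(pda_step D)\<^sup>*\<^sup>* (init_state D, w, [init_symbol D]) (f, [], \<tau>)" "f \<in> final_states D"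
      using w unfolding pda_language_def by blast
    obtain n where n: "(pda_step D ^^ n) (init_state D, w, [init_symbol D]) (f, [], \<tau>)"
      using f(1) by (meson rtranclp_imp_relpowp)
    have "reaches_target D None f \<tau>" "None \<in> pda_targets D" "set [init_symbol D] \<subseteq> pda_symbols D"
      using f(2) by (simp_all add: reaches_target_def pda_targets_def pda_symbols_def)
    from guesses_complete[OF n this] show ?thesis by blast
  qed
  ultimately show ?thesis
    unfolding context_free_language_def using finite_pda_productions[OF assms]
    by (intro exI[of _ ?P] exI[of _ ?S]) auto
qed

section \<open>Directly finite monoids\<close>

definition directly_finite :: "('m, 'x) monoid_scheme \<Rightarrow> bool" where
  "directly_finite M \<longleftrightarrow>
     (\<forall>x\<in>carrier M. \<forall>y\<in>carrier M. x \<otimes>\<^bsub>M\<^esub> y = \<one>\<^bsub>M\<^esub> \<longrightarrow> y \<otimes>\<^bsub>M\<^esub> x = \<one>\<^bsub>M\<^esub>)"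

text \<open>An inverse \<open>u\<close> of \<open>x \<otimes> y\<close> provides the right inverse
  \<open>y \<otimes> u\<close> of \<open>x\<close> and the left inverse \<open>u \<otimes> x\<close>
  of \<open>y\<close>; direct finiteness makes both two-sided.\<close>

lemma (in monoid) directly_finite_factors:
  assumes fin: "directly_finite G" and xy: "x \<in> carrier G" "y \<in> carrier G" "x \<otimes> y \<in> Units G"
  shows "x \<in> Units G" "y \<in> Units G"
proof -
  obtain u where u: "u \<in> carrier G" "x \<otimes> y \<otimes> u = \<one>" "u \<otimes> (x \<otimes> y) = \<one>"
    using xy(3) unfolding Units_def by auto
  have r: "x \<otimes> (y \<otimes> u) = \<one>" "(u \<otimes> x) \<otimes> y = \<one>" using u xy(1,2) by (simp_all add: m_assoc)
  then have "(y \<otimes> u) \<otimes> x = \<one>" "y \<otimes> (u \<otimes> x) = \<one>"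
    using fin xy(1,2) u(1) unfolding directly_finite_def by simp_all
  with r show "x \<in> Units G" "y \<in> Units G"
    using xy(1,2) u(1) unfolding Units_def by blast+
qed

section \<open>Values of words and membership in the word problem\<close>

lemma word_value_Nil [simp]: "word_value M f [] = \<one>\<^bsub>M\<^esub>"
  by (simp add: word_value_def)

lemma word_value_Cons [simp]: "word_value M f (a # w) = f a \<otimes>\<^bsub>M\<^esub> word_value M f w"
  by (simp add: word_value_def)

context monoid
begin

lemma word_value_closed:
  "f \<in> A \<rightarrow> carrier G \<Longrightarrow> w \<in> lists A \<Longrightarrow> word_value G f w \<in> carrier G"
  by (induction w) auto

lemma word_value_append:
  "f \<in> A \<rightarrow> carrier G \<Longrightarrow> u \<in> lists A \<Longrightarrow> v \<in> lists A \<Longrightarrow>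
     word_value G f (u @ v) = word_value G f u \<otimes> word_value G f v"
proof (induction u)
  case (Cons a u)
  then have "f a \<in> carrier G" by auto
  then show ?case using Cons by (simp add: m_assoc word_value_closed)
qed (simp add: word_value_closed)

lemma word_value_pow:
  "f \<in> A \<rightarrow> carrier G \<Longrightarrow> w \<in> lists A \<Longrightarrow> word_value G f (word_pow w n) = word_value G f w [^] n"
proof (induction n)
  case 0
  then show ?case by simp
next
  case (Suc n)
  have "word_pow w n \<in> lists A" using Suc.prems(2) by (induction n) auto
  then show ?case
    using Suc word_value_append[of f A w "word_pow w n"] nat_pow_Suc2[OF word_value_closed[OF Suc.prems], of n]
    by simp
qed

end

lemma map_word_pow: "map f (word_pow w n) = word_pow (map f w) n"
  by (induction n) auto

lemma rev_word_pow: "rev (word_pow w n) = word_pow (rev w) n"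
proof (induction n)
  case (Suc n)
  then show ?case using word_pow_Suc2[of "rev w" n] by simp
qed simp

lemma word_pow_in_lists: "w \<in> lists A \<Longrightarrow> word_pow w n \<in> lists A"
  by (induction n) auto

text \<open>The single separator \<open>None\<close> fixes the decomposition, so \<open>u\<close>
  and \<open>v\<close> can be read off the word.\<close>

lemma word_problem_mem:
  fixes A :: "'a set"
  assumes "u \<in> lists A" "v \<in> lists A"
  shows "map Some u @ [None] @ map Some (rev v) \<in> word_problem M A f \<longleftrightarrow>
    word_value M f u = word_value M f v"
proof
  assume "map Some u @ [None] @ map Some (rev v) \<in> word_problem M A f"
  then obtain u' v' where h: "map Some u @ [None] @ map Some (rev v) = map Some u' @ [None] @ map Some (rev v')"
    "word_value M f u' = word_value M f v'" unfolding word_problem_def by auto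
  have "takeWhile (\<lambda>x. x \<noteq> None) (map Some w @ [None] @ r) = map Some w" for w :: "'a list" and r
    by (induction w) auto
  from this[of u] this[of u'] have "map Some u = map Some u'" using h(1) by metis
  then have "u = u'" "v = v'" using h(1) by (auto simp: inj_map_eq_map)
  then show "word_value M f u = word_value M f v" using h(2) by simp
next
  assume "word_value M f u = word_value M f v"
  then show "map Some u @ [None] @ map Some (rev v) \<in> word_problem M A f"
    using assms unfolding word_problem_def by blast
qed

section \<open>Bicyclic relations and direct finiteness\<close>

context monoid
begin

lemma bicyclic_cancel:
  assumes "p \<in> carrier G" "q \<in> carrier G" "p \<otimes> q = \<one>"
  shows "p [^] (n::nat) \<otimes> q [^] n = \<one>"
proof (induction n)
  case 0
  then show ?case by simp
next
  case (Suc n)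
  have "p [^] Suc n \<otimes> q [^] Suc n = p [^] n \<otimes> (p \<otimes> q) \<otimes> q [^] n"
    using assms(1,2) by (simp add: nat_pow_Suc2 m_assoc del: nat_pow_Suc) (simp add: nat_pow_Suc2[symmetric] m_assoc)
  then show ?case using Suc assms by simp
qed

text \<open>Otherwise \<open>q\<close> has a right inverse \<open>q^(n-1) x\<close> besides its left
  inverse \<open>p\<close>; the two agree, so \<open>q p = 1\<close>.\<close>

lemma bicyclic_power_not_right_inverse:
  assumes "p \<in> carrier G" "q \<in> carrier G" "p \<otimes> q = \<one>" "q \<otimes> p \<noteq> \<one>"
    and "x \<in> carrier G" "q [^] (n::nat) \<otimes> x = \<one>"
  shows "n = 0"
proof (cases n)
  case (Suc m)
  define y where "y = q [^] m \<otimes> x"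
  have "q \<otimes> y = q [^] Suc m \<otimes> x"
    unfolding nat_pow_Suc2[OF assms(2)] y_def using assms(2,5) by (simp add: m_assoc del: nat_pow_Suc)
  then have y: "y \<in> carrier G" "q \<otimes> y = \<one>"
    using assms(2,5,6) Suc by (simp_all add: y_def del: nat_pow_Suc)
  have "y = (p \<otimes> q) \<otimes> y" using assms y by simp
  also have "\<dots> = p \<otimes> (q \<otimes> y)" using assms(1,2) y(1) by (rule m_assoc)
  also have "\<dots> = p" using assms(1) y(2) by simp
  finally show ?thesis using y assms by simp
qed simp

text \<open>Reduce \<open>p^n q^m\<close> by \<open>p q = 1\<close>. For \<open>n \<le> m\<close>
  both sides become powers of \<open>q\<close>, which are distinct. For \<open>n = e + m\<close>
  with \<open>e > 0\<close> there remains \<open>q^i = q^k p^e\<close>; multiplying by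
  \<open>q^e\<close> on the right gives \<open>k = i + e\<close>, and multiplying by
  \<open>p^i\<close> on the left gives \<open>q^e p^e = 1\<close>, a right inverse of
  \<open>q^e\<close>.\<close>

lemma bicyclic_eq:
  fixes i k n m :: nat
  assumes pq: "p \<in> carrier G" "q \<in> carrier G" "p \<otimes> q = \<one>" "q \<otimes> p \<noteq> \<one>"
    and eq: "q [^] i = q [^] k \<otimes> p [^] n \<otimes> q [^] m"
  shows "n \<le> m \<and> i + n = k + m"
proof -
  note c = bicyclic_cancel[OF pq(1-3)] and pw = nat_pow_closed[OF pq(1)] nat_pow_closed[OF pq(2)]
  note z = bicyclic_power_not_right_inverse[OF pq]
  have inj: "a = b" if h: "q [^] a = q [^] b" for a b :: nat
  proof -
    have "a \<le> b" if h: "q [^] a = q [^] b" for a b :: nat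
    proof (rule ccontr)
      assume "\<not> a \<le> b"
      then obtain e where e: "a = b + e" "e > 0" by (metis less_imp_add_positive not_le)
      have "q [^] e = (p [^] b \<otimes> q [^] b) \<otimes> q [^] e" using c pw by simp
      also have "\<dots> = p [^] b \<otimes> q [^] a" using e pw pq by (simp add: m_assoc nat_pow_mult[symmetric])
      also have "\<dots> = \<one>" using h c by simp
      finally show False using z[of "\<one>" e] e pw by simp
    qed
    from this[of a b] this[of b a] show ?thesis using h by simp
  qed
  show ?thesis
  proof (cases "n \<le> m")
    case True
    then obtain e where e: "m = n + e" using le_Suc_ex by blast
    have "p [^] n \<otimes> q [^] m = (p [^] n \<otimes> q [^] n) \<otimes> q [^] e"
      using e pw pq by (simp add: m_assoc nat_pow_mult[symmetric])
    then have "q [^] i = q [^] (k + e)"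
      using eq c pw pq by (simp add: m_assoc nat_pow_mult[symmetric])
    then show ?thesis using inj e by auto
  next
    case False
    then obtain e where e: "n = e + m" "e > 0" by (metis add.commute less_imp_add_positive not_le)
    have "p [^] n \<otimes> q [^] m = p [^] e \<otimes> (p [^] m \<otimes> q [^] m)"
      using e pw pq by (simp add: m_assoc nat_pow_mult[symmetric])
    then have i: "q [^] i = q [^] k \<otimes> p [^] e"
      using eq c pw pq by (simp add: m_assoc)
    have "q [^] (i + e) = q [^] k \<otimes> p [^] e \<otimes> q [^] e"
      using i pq by (simp add: nat_pow_mult[symmetric])
    then have "q [^] (i + e) = q [^] k" using c pw by (simp add: m_assoc)
    then have k: "k = i + e" using inj by blast
    have "q [^] e \<otimes> p [^] e = (p [^] i \<otimes> q [^] i) \<otimes> (q [^] e \<otimes> p [^] e)" using c pw by simp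
    also have "\<dots> = p [^] i \<otimes> (q [^] k \<otimes> p [^] e)"
      using k pw pq by (simp add: m_assoc nat_pow_mult[symmetric])
    also have "\<dots> = \<one>" by (simp add: i[symmetric] c)
    finally show ?thesis using z[of "p [^] e" e] pw e by simp
  qed
qed

lemma bicyclic_eq_iff:
  fixes i k n m :: nat
  assumes pq: "p \<in> carrier G" "q \<in> carrier G" "p \<otimes> q = \<one>" "q \<otimes> p \<noteq> \<one>"
  shows "q [^] i = q [^] k \<otimes> p [^] n \<otimes> q [^] m \<longleftrightarrow> n \<le> m \<and> i + n = k + m"
proof
  assume h: "n \<le> m \<and> i + n = k + m"
  then obtain e where e: "m = n + e" "i = k + e"
    by (metis add.assoc add.commute add_right_cancel le_Suc_ex)
  have "p [^] n \<otimes> q [^] m = (p [^] n \<otimes> q [^] n) \<otimes> q [^] e"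
    using e pq by (simp add: m_assoc nat_pow_mult[symmetric])
  then show "q [^] i = q [^] k \<otimes> p [^] n \<otimes> q [^] m"
    using bicyclic_cancel[OF pq(1-3)] e pq by (simp add: m_assoc nat_pow_mult[symmetric])
qed (rule bicyclic_eq[OF pq])

lemma directly_finite_if_deterministic:
  assumes gen: "generates_monoid G A f"
    and dcfl: "deterministic_context_free_language (word_problem G A f)"
  shows "directly_finite G"
  unfolding directly_finite_def
proof (intro ballI impI, rule ccontr)
  fix p q
  assume pq: "p \<in> carrier G" "q \<in> carrier G" "p \<otimes> q = \<one>" "q \<otimes> p \<noteq> \<one>"
  have f: "f \<in> A \<rightarrow> carrier G" using gen unfolding generates_monoid_def by blast
  obtain P where P: "P \<in> lists A" "p = word_value G f P"
    using gen pq(1) unfolding generates_monoid_def by blast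
  obtain Q where Q: "Q \<in> lists A" "q = word_value G f Q"
    using gen pq(2) unfolding generates_monoid_def by blast
  obtain D where D: "finite (transitions D)" "deterministic_pda D" "word_problem G A f = pda_language D"
    using dcfl unfolding deterministic_context_free_language_def by blast
  \<comment> \<open>\<open>Q = []\<close> would mean \<open>q = 1\<close>, hence
    \<open>p = 1\<close> and \<open>q p = 1\<close>.\<close>
  have ne: "map Some Q \<noteq> []" using Q(2) pq by auto
  have mem: "word_pow (map Some Q) i @ [None] @ word_pow (map Some (rev Q)) m @ word_pow (map Some (rev P)) n @
      word_pow (map Some (rev Q)) k \<in> pda_language D \<longleftrightarrow> n \<le> m \<and> i + n = k + m" for i m n k
  proof -
    have l: "word_pow Q j \<in> lists A" "word_pow P j \<in> lists A" for j
      using P Q by (simp_all only: word_pow_in_lists)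
    \<comment> \<open>Its reversal is \<open>Y^m Z^n Y^k\<close> with \<open>Y = rev Q\<close> and
      \<open>Z = rev P\<close>.\<close>
    let ?v = "word_pow Q k @ word_pow P n @ word_pow Q m"
    have "word_value G f (word_pow Q i) = q [^] i" "word_value G f ?v = q [^] k \<otimes> p [^] n \<otimes> q [^] m"
      using l P Q pq
      by (simp_all only: word_value_append[OF f] append_in_lists_conv word_value_pow[OF f]
          m_assoc nat_pow_closed simp_thms)
    then show ?thesis
      using word_problem_mem[of "word_pow Q i" A ?v G f] l bicyclic_eq_iff[OF pq]
      by (simp add: map_word_pow rev_word_pow rev_map[symmetric] D(3))
  qed
  show False
  proof (rule no_deterministic_pda_for_bicyclic[OF D(2,1) ne])
    show "word_pow (map Some Q) i @ [None] @ word_pow (map Some (rev Q)) m \<in> pda_language D \<longleftrightarrow> i = m" for i m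
      using mem[of i m 0 0] by simp
    show "word_pow (map Some Q) i @ [None] @ word_pow (map Some (rev Q)) m @ word_pow (map Some (rev P)) m @
      word_pow (map Some (rev Q)) i \<in> pda_language D" for i m
      using mem by simp
    show "m \<le> m' \<and> i' + m = i + m'"
      if "word_pow (map Some Q) i' @ [None] @ word_pow (map Some (rev Q)) m' @ word_pow (map Some (rev P)) m @
      word_pow (map Some (rev Q)) i \<in> pda_language D" for i m i' m'
      using that mem by blast
  qed
qed

end

section \<open>The group of units\<close>

text \<open>An accepting run reads every letter of its input, so deleting the moves that read
  letters outside \<open>B\<close> loses exactly the words containing such a letter. Silent moves
  stay.\<close>

lemma pda_language_restrict:
  fixes D :: "'a pda" and B :: "'a set"
  defines "D' \<equiv> D\<lparr>transitions := {(q, x, Z, p, \<gamma>) \<in> transitions D. set_option x \<subseteq> B}\<rparr>"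
  shows "pda_language D' = pda_language D \<inter> lists B"
proof -
  have sub: "(pda_step D)\<^sup>*\<^sup>* (q, u, \<sigma>) (p, v, \<tau>) \<and> (v \<in> lists B \<longrightarrow> u \<in> lists B)"
    if "(pda_step D')\<^sup>*\<^sup>* (q, u, \<sigma>) (p, v, \<tau>)" for q u \<sigma> p v \<tau>
    using that
  proof (induction "(p, v, \<tau>)" arbitrary: p v \<tau> rule: rtranclp_induct)
    case base
    then show ?case by simp
  next
    case (step y)
    obtain p1 v1 \<tau>1 where y: "y = (p1, v1, \<tau>1)" by (cases y)
    have "pda_step D (p1, v1, \<tau>1) (p, v, \<tau>) \<and> (v \<in> lists B \<longrightarrow> v1 \<in> lists B)"
      using step(2) unfolding y D'_def
      by cases (auto intro: pda_step.intros)
    then show ?case using step(3)[OF y] y by (meson rtranclp.rtrancl_into_rtrancl)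
  qed
  have sup: "(pda_step D')\<^sup>*\<^sup>* (q, u, \<sigma>) (p, v, \<tau>) \<and> v \<in> lists B"
    if "(pda_step D)\<^sup>*\<^sup>* (q, u, \<sigma>) (p, v, \<tau>)" "u \<in> lists B" for q u \<sigma> p v \<tau>
    using that
  proof (induction "(p, v, \<tau>)" arbitrary: p v \<tau> rule: rtranclp_induct)
    case base
    then show ?case by simp
  next
    case (step y)
    obtain p1 v1 \<tau>1 where y: "y = (p1, v1, \<tau>1)" by (cases y)
    have IH: "(pda_step D')\<^sup>*\<^sup>* (q, u, \<sigma>) y" "v1 \<in> lists B" using step(3)[OF y] step.prems y by auto
    from step(2) have "pda_step D' (p1, v1, \<tau>1) (p, v, \<tau>) \<and> v \<in> lists B"
      unfolding y
    proof cases
      case (read a Z \<gamma> \<sigma>')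
      then have "(p1, Some a, Z, p, \<gamma>) \<in> transitions D'" using IH(2) by (simp add: D'_def)
      then show ?thesis using read IH(2) by (auto intro: pda_step.intros)
    next
      case (silent Z \<gamma> \<sigma>')
      then have "(p1, None, Z, p, \<gamma>) \<in> transitions D'" by (simp add: D'_def)
      then show ?thesis using silent IH(2) by (auto intro: pda_step.intros)
    qed
    then show ?case using IH(1) y by (meson rtranclp.rtrancl_into_rtrancl)
  qed
  have "init_state D' = init_state D" "init_symbol D' = init_symbol D" "final_states D' = final_states D"
    by (simp_all add: D'_def)
  then show ?thesis
    unfolding pda_language_def using sub sup by auto blast+
qed

lemma (in monoid) context_free_units:
  assumes fin: "directly_finite G" and A: "finite (A :: nat set)" and gen: "generates_monoid G A f"
    and dcfl: "deterministic_context_free_language (word_problem G A f)"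
  shows "context_free_group (units_of G)"
proof -
  define B where "B = {a \<in> A. f a \<in> Units G}"
  have f: "f \<in> A \<rightarrow> carrier G" using gen unfolding generates_monoid_def by blast
  have value_units: "word_value (units_of G) f w = word_value G f w" for w :: "nat list"
    by (induction w) (simp_all add: units_of_mult units_of_one)
  have closed: "word_value G f w \<in> Units G" if "w \<in> lists B" for w
    using that by (induction w) (auto simp: B_def)
  \<comment> \<open>Direct finiteness passes invertibility from a product to its factors; hence the
    invertible generators alone generate \<open>Units G\<close>.\<close>
  have letters: "w \<in> lists B" if "w \<in> lists A" "word_value G f w \<in> Units G" for w
    using that
  proof (induction w)
    case Nil
    then show ?case by simp
  next
    case (Cons a w)
    then have "f a \<in> Units G" "word_value G f w \<in> Units G"
      using directly_finite_factors[OF fin, of "f a" "word_value G f w"] f word_value_closed[OF f] by auto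
    then show ?case using Cons by (auto simp: B_def)
  qed
  have "Units G \<subseteq> word_value G f ` lists B"
  proof
    fix x assume x: "x \<in> Units G"
    then obtain w where "w \<in> lists A" "x = word_value G f w"
      using gen Units_closed unfolding generates_monoid_def by blast
    then show "x \<in> word_value G f ` lists B" using letters x by blast
  qed
  then have gen': "generates_monoid (units_of G) B f"
    unfolding generates_monoid_def units_of_carrier using closed
    by (auto simp: value_units B_def)
  obtain D where D: "finite (transitions D)" "finite (final_states D)" "word_problem G A f = pda_language D"
    using dcfl unfolding deterministic_context_free_language_def by blast
  define D' where "D' = D\<lparr>transitions := {(q, x, Z, p, \<gamma>) \<in> transitions D. set_option x \<subseteq> insert None (Some ` B)}\<rparr>"
  \<comment> \<open>Values in \<open>units_of G\<close> are values in \<open>G\<close>, so the two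
    word problems differ only in the letters allowed.\<close>
  have "word_problem (units_of G) B f = word_problem G A f \<inter> lists (insert None (Some ` B))"
    unfolding word_problem_def value_units
    by (auto simp: B_def in_lists_conv_set) blast+
  then have "word_problem (units_of G) B f = pda_language D'"
    unfolding D'_def by (simp add: pda_language_restrict D(3))
  moreover have "finite (transitions D')" "finite (final_states D')"
    using D(1,2) by (auto simp: D'_def intro: finite_subset[rotated])
  ultimately have "context_free_language (word_problem (units_of G) B f)"
    using context_free_pda_language by metis
  moreover have "finite B" using A by (simp add: B_def)
  ultimately show ?thesis
    unfolding context_free_group_def using gen' units_group by blast
qed

section \<open>Special monoids\<close>

lemma pres_cong_in_lists: "(u, v) \<in> pres_cong A R \<Longrightarrow> u \<in> lists A \<and> v \<in> lists A"
  by (induction rule: pres_cong.induct) auto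

lemma equiv_pres_cong: "equiv (lists A) (pres_cong A R)"
proof (rule equivI)
  show "pres_cong A R \<subseteq> lists A \<times> lists A" by (rule subrelI, drule pres_cong_in_lists) simp
  show "refl_on (lists A) (pres_cong A R)" by (simp add: refl_on_def pres_cong.refl)
  show "sym (pres_cong A R)" by (rule symI) (rule pres_cong.sym)
  show "trans (pres_cong A R)" by (rule transI) (rule pres_cong.trans)
qed

lemma pres_cong_context:
  assumes "(u, v) \<in> pres_cong A R" "x \<in> lists A" "y \<in> lists A"
  shows "(x @ u @ y, x @ v @ y) \<in> pres_cong A R"
  using assms
proof (induction rule: pres_cong.induct)
  case (rel u v x' y')
  then show ?case using pres_cong.rel[of u v R A "x @ x'" "y' @ y"] by simp
next
  case (refl u)
  then show ?case by (simp add: pres_cong.refl)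
next
  case (sym u v)
  show ?case by (rule pres_cong.sym[OF sym.IH[OF sym.prems]])
next
  case (trans u v w)
  show ?case by (rule pres_cong.trans[OF trans.IH(1)[OF trans.prems] trans.IH(2)[OF trans.prems]])
qed

lemma pres_cong_append:
  assumes "(u, u') \<in> pres_cong A R" "(v, v') \<in> pres_cong A R"
  shows "(u @ v, u' @ v') \<in> pres_cong A R"
proof (rule pres_cong.trans)
  show "(u @ v, u' @ v) \<in> pres_cong A R"
    using pres_cong_context[OF assms(1), of "[]" v] pres_cong_in_lists[OF assms(2)] by simp
  show "(u' @ v, u' @ v') \<in> pres_cong A R"
    using pres_cong_context[OF assms(2), of u' "[]"] pres_cong_in_lists[OF assms(1)] by simp
qed

lemma presented_monoid_mult:
  assumes "u \<in> lists A" "v \<in> lists A"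
  shows "pres_cong A R `` {u} \<otimes>\<^bsub>presented_monoid A R\<^esub> pres_cong A R `` {v} = pres_cong A R `` {u @ v}"
proof -
  have "pres_cong A R `` {u' @ v'} = pres_cong A R `` {u @ v}"
    if "(u, u') \<in> pres_cong A R" "(v, v') \<in> pres_cong A R" for u' v'
    using equiv_class_eq[OF equiv_pres_cong pres_cong_append[OF that]] by simp
  moreover have "(u, u) \<in> pres_cong A R" "(v, v) \<in> pres_cong A R"
    using assms by (auto intro: pres_cong.refl)
  ultimately show ?thesis
    unfolding presented_monoid_def monoid.simps by blast
qed

text \<open>The class map followed by the inverse isomorphism evaluates words in \<open>G\<close>,
  so that later arguments handle words and elements instead of classes.\<close>

lemma (in monoid) presentation_evaluation:
  assumes "G \<cong> presented_monoid A R"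
  obtains f where "f ` lists A = carrier G" "f [] = \<one>"
    "\<And>u v. u \<in> lists A \<Longrightarrow> v \<in> lists A \<Longrightarrow> f (u @ v) = f u \<otimes> f v"
    "\<And>u v. u \<in> lists A \<Longrightarrow> v \<in> lists A \<Longrightarrow> f u = f v \<longleftrightarrow> (u, v) \<in> pres_cong A R"
proof -
  let ?N = "presented_monoid A R"
  obtain h where h: "h \<in> hom G ?N" "bij_betw h (carrier G) (carrier ?N)"
    using assms unfolding is_iso_def iso_def by auto
  define k where "k = inv_into (carrier G) h"
  define f where "f w = k (pres_cong A R `` {w})" for w
  have N: "carrier ?N = (\<lambda>w. pres_cong A R `` {w}) ` lists A"
    unfolding presented_monoid_def quotient_def by auto
  have k: "bij_betw k (carrier ?N) (carrier G)"
    unfolding k_def using h(2) by (rule bij_betw_inv_into)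
  have cls: "pres_cong A R `` {w} \<in> carrier ?N" if "w \<in> lists A" for w
    using that N by blast
  have hf: "h (f w) = pres_cong A R `` {w}" if "w \<in> lists A" for w
    unfolding f_def k_def using bij_betw_inv_into_right[OF h(2) cls[OF that]] .
  have im: "f ` lists A = carrier G"
    using bij_betw_imp_surj_on[OF k] unfolding N f_def by (simp add: image_image)
  then have cl: "f w \<in> carrier G" if "w \<in> lists A" for w using that by blast
  have inj: "x = y" if "x \<in> carrier G" "y \<in> carrier G" "h x = h y" for x y
    using that h(2) unfolding bij_betw_def inj_on_def by blast
  have app: "f (u @ v) = f u \<otimes> f v" if uv: "u \<in> lists A" "v \<in> lists A" for u v
  proof (rule inj)
    show "h (f (u @ v)) = h (f u \<otimes> f v)"
      using uv h(1) cl by (simp add: hf hom_mult presented_monoid_mult)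
  qed (use uv cl in auto)
  \<comment> \<open>Membership in \<open>hom\<close> says nothing about identity elements;
    \<open>f []\<close> is recognised as a left identity on the image of \<open>f\<close>, which is
    all of \<open>G\<close>.\<close>
  have "f [] \<otimes> x = x" if x: "x \<in> carrier G" for x
  proof -
    obtain w where "w \<in> lists A" "x = f w" using x im by blast
    then show ?thesis using app[of "[]" w] by simp
  qed
  from this[of \<one>] have one: "f [] = \<one>" using cl[of "[]"] by simp
  have eq: "f u = f v \<longleftrightarrow> (u, v) \<in> pres_cong A R" if uv: "u \<in> lists A" "v \<in> lists A" for u v
  proof -
    have "f u = f v \<longleftrightarrow> pres_cong A R `` {u} = pres_cong A R `` {v}"
      using hf uv unfolding f_def by metis
    then show ?thesis using eq_equiv_class_iff[OF equiv_pres_cong uv] by simp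
  qed
  show ?thesis by (rule that[OF im one app eq])
qed

text \<open>Without an occurrence of \<open>a\<close> the value is \<open>[]\<close>, as
  \<open>tl [] = []\<close>; with this default the invariance below also covers words without
  \<open>a\<close>.\<close>

definition before_last :: "'a \<Rightarrow> 'a list \<Rightarrow> 'a list" where
  "before_last a w = rev (tl (dropWhile (\<lambda>b. b \<noteq> a) (rev w)))"

lemma before_last_in_lists: "w \<in> lists A \<Longrightarrow> before_last a w \<in> lists A"
proof -
  have "set (tl (dropWhile P xs)) \<subseteq> set xs" for P and xs :: "'a list"
    by (induction xs) auto
  then show "w \<in> lists A \<Longrightarrow> before_last a w \<in> lists A"
    unfolding before_last_def in_lists_conv_set by fastforce
qed

lemma before_last_append:
  "before_last a (u @ v) = (if a \<in> set v then u @ before_last a v else before_last a u)"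
proof (cases "a \<in> set v")
  case True
  have "dropWhile (\<lambda>b. b \<noteq> a) (rev v) \<noteq> []" using True by simp
  then show ?thesis using True by (simp add: before_last_def dropWhile_append1 tl_append2)
next
  case False
  then have "dropWhile (\<lambda>b. b \<noteq> a) (rev v @ rev u) = dropWhile (\<lambda>b. b \<noteq> a) (rev u)"
    by (intro dropWhile_append2) auto
  then show ?thesis using False by (simp add: before_last_def)
qed

text \<open>A letter outside all relators is rigid: the prefix before its last occurrence is an invariant.\<close>

lemma pres_cong_before_last:
  assumes "(u, v) \<in> pres_cong A R" "\<And>x y. (x, y) \<in> R \<Longrightarrow> a \<notin> set x \<and> a \<notin> set y"
  shows "(before_last a u, before_last a v) \<in> pres_cong A R"
  using assms(1)
proof (induction rule: pres_cong.induct)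
  case (rel u v x y)
  \<comment> \<open>Either the last \<open>a\<close> lies in \<open>y\<close> and the relation is
    still applied in front of it, or both values are \<open>before_last a x\<close>.\<close>
  have "before_last a x \<in> lists A" "before_last a y \<in> lists A"
    using rel by (simp_all only: before_last_in_lists)
  then have "(before_last a x, before_last a x) \<in> pres_cong A R"
    "(x @ u @ before_last a y, x @ v @ before_last a y) \<in> pres_cong A R"
    using pres_cong.rel[OF rel(1-4)] by (simp_all add: pres_cong.refl)
  then show ?case
    using assms(2)[OF rel(1)] by (simp add: before_last_append)
next
  case (refl u)
  then show ?case by (intro pres_cong.refl before_last_in_lists)
next
  case (sym u v)
  show ?case by (rule pres_cong.sym[OF sym.IH])
next
  case (trans u v w)
  show ?case by (rule pres_cong.trans[OF trans.IH])
qed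

text \<open>It suffices to cancel one letter. A letter of a relator is a factor of
  \<open>\<one>\<close>, hence a unit; any other letter is removed by comparing the prefixes before
  its last occurrence.\<close>

lemma (in monoid) right_cancellative_if_directly_finite:
  assumes fin: "directly_finite G" and W: "W \<subseteq> lists A"
    and iso: "G \<cong> presented_monoid A {(w, []) | w. w \<in> W}"
  shows "right_cancellative G"
proof -
  let ?R = "{(w, []) | w. w \<in> W}"
  obtain f where f: "f ` lists A = carrier G" "f [] = \<one>"
    "\<And>u v. u \<in> lists A \<Longrightarrow> v \<in> lists A \<Longrightarrow> f (u @ v) = f u \<otimes> f v"
    "\<And>u v. u \<in> lists A \<Longrightarrow> v \<in> lists A \<Longrightarrow> f u = f v \<longleftrightarrow> (u, v) \<in> pres_cong A ?R"
    using presentation_evaluation[OF iso] by blast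
  have cl: "f w \<in> carrier G" if "w \<in> lists A" for w using that f(1) by blast
  have letter_unit: "f [a] \<in> Units G" if "f w \<in> Units G" "w \<in> lists A" "a \<in> set w" for a w
    using that
  proof (induction w)
    case (Cons b w)
    then have b: "[b] \<in> lists A" "w \<in> lists A" by auto
    have "f [b] \<otimes> f w \<in> Units G" using Cons.prems(1) f(3)[OF b] by simp
    then have "f [b] \<in> Units G" "f w \<in> Units G"
      using directly_finite_factors[OF fin] cl b by blast+
    then show ?case using Cons b by auto
  qed simp
  have cancel_letter: "f u = f v"
    if uv: "u \<in> lists A" "v \<in> lists A" "a \<in> A" and eq: "f (u @ [a]) = f (v @ [a])" for u v a
  proof (cases "\<exists>w\<in>W. a \<in> set w")
    case True
    then obtain w where w: "w \<in> W" "a \<in> set w" by blast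
    then have "(w, []) \<in> pres_cong A ?R"
      using pres_cong.rel[of w "[]" ?R A "[]" "[]"] W by auto
    then have "f w = \<one>" using f(2) f(4)[of w "[]"] w(1) W by auto
    then have "f [a] \<in> Units G" using letter_unit w W by (metis Units_one_closed subsetD)
    then obtain z where z: "z \<in> carrier G" "f [a] \<otimes> z = \<one>" unfolding Units_def by auto
    have "f u \<otimes> f [a] \<otimes> z = f v \<otimes> f [a] \<otimes> z" using eq uv f(3) by simp
    then show ?thesis using z uv cl[of u] cl[of v] cl[of "[a]"] by (simp add: m_assoc)
  next
    case False
    have "(before_last a (u @ [a]), before_last a (v @ [a])) \<in> pres_cong A ?R"
      by (rule pres_cong_before_last) (use f(4) uv eq False in auto)
    \<comment> \<open>The last \<open>a\<close> of \<open>u @ [a]\<close> is the appended one, so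
      the prefix before it is \<open>u\<close>.\<close>
    then show ?thesis using f(4) uv by (simp add: before_last_append) (simp add: before_last_def)
  qed
  have cancel: "f u = f v" if "w \<in> lists A" "u \<in> lists A" "v \<in> lists A" "f (u @ w) = f (v @ w)" for u v w
    using that
  proof (induction w arbitrary: u v)
    case (Cons a w)
    \<comment> \<open>Rebracket \<open>u @ (a # w)\<close> as \<open>(u @ [a]) @ w\<close>; the
      induction hypothesis removes \<open>w\<close> and leaves one letter.\<close>
    have "f (u @ [a]) = f (v @ [a])" by (rule Cons.IH) (use Cons.hyps Cons.prems in auto)
    from cancel_letter[OF Cons.prems(1,2) Cons.hyps(1) this] show ?case .
  qed simp
  show ?thesis
    unfolding right_cancellative_def
  proof (intro ballI impI)
    fix a b c assume abc: "a \<in> carrier G" "b \<in> carrier G" "c \<in> carrier G" and eq: "a \<otimes> c = b \<otimes> c"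
    obtain u v w where u: "u \<in> lists A" "a = f u" and v: "v \<in> lists A" "b = f v" and w: "w \<in> lists A" "c = f w"
      using abc unfolding f(1)[symmetric] by blast
    have "f (u @ w) = f (v @ w)" using f(3) u v w eq by simp
    then show "a = b" using cancel u v w by blast
  qed
qed

theorem proposition3p7:
  fixes M :: "('m, 'x) monoid_scheme"
  assumes "fp_special_monoid M"
    and "dcf_word_problem M"
  shows "right_cancellative M \<and> context_free_group (units_of M)"
proof -
  interpret monoid M using assms(1) by (simp add: fp_special_monoid_def)
  obtain A :: "nat set" and W where W: "W \<subseteq> lists A" "M \<cong> presented_monoid A {(w, []) | w. w \<in> W}"
    using assms(1) unfolding fp_special_monoid_def by blast
  obtain B :: "nat set" and f where B: "finite B" "generates_monoid M B f"
    "deterministic_context_free_language (word_problem M B f)"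
    using assms(2) unfolding dcf_word_problem_def by blast
  have "directly_finite M" using directly_finite_if_deterministic B(2,3) by blast
  then show ?thesis
    using right_cancellative_if_directly_finite[OF _ W] context_free_units[OF _ B] by blast
qed

end
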